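(* Let $\Omega\subset\mathbb{R}^n$ be a bounded open set with $0\in\partial\Omega$, let $r_0>0$, and let $\psi$ be a non-negative, non-decreasing function on $[0,r_0]$ with $\psi(r_0)<r_0$ and $$I(\psi):=\int_0^{r_0}\frac{\psi(r)\,dr}{r^2}<\infty .$$ Let $Q:=\{x=(x',x_n)\in\mathbb{R}^n:\ |x'|<r_0,\ 0<x_n-\psi(|x'|)<r_0\}$ and suppose that $Q\subset\Omega$ (interior $Q$-condition at $0$). Let $Lu:=\sum_{i,j}a_{ij}D_{ij}u$ be a uniformly elliptic operator with bounded measurable coefficients. Then for any function $u\in C^2(\Omega)\cap C(\overline{\Omega})$ satisfying $u>0$ and $Lu\le 0$ in $\Omega$, and $u(0)=0$, we have $$\liminf_{t\to0^+}\,t^{-1}u(t\,l)>0\quad\text{for each } l\in\mathbb{R}^n_+:=\{x\in\mathbb{R}^n:\ x_n>0\}.$$ (Here, for each $l\in\mathbb{R}^n_+$, one has $t\,l\in Q\subset\Omega$ for all sufficiently small $t>0$, so that $u(t\,l)$ is well defined.)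
   Context: Points of $\mathbb{R}^n$ are written $x=(x',x_n)$ with $x'=(x_1,\dots,x_{n-1})\in\mathbb{R}^{n-1}$. $D_iu=\partial u/\partial x_i$, $D_{ij}u=D_iD_ju$. The coefficients of $L$ satisfy $a_{ij}=a_{ji}\in L^\infty(\mathbb{R}^n)$ and the uniform ellipticity condition $\nu|\xi|^2\le\sum_{i,j}a_{ij}\xi_i\xi_j\le\nu^{-1}|\xi|^2$ for all $\xi\in\mathbb{R}^n$, with a constant $\nu\in(0,1]$; no continuity of $a_{ij}$ is assumed, and $L$ has no lower order terms. *)

theory Defs
  imports "HOL-Analysis.Analysis"
begin

definition has_partial :: "'n::finite \<Rightarrow> (real ^ 'n \<Rightarrow> real) \<Rightarrow> real ^ 'n \<Rightarrow> bool" where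
  "has_partial i u x \<longleftrightarrow> (\<lambda>t. u (x + t *\<^sub>R axis i 1)) field_differentiable at 0"

definition D :: "'n::finite \<Rightarrow> (real ^ 'n \<Rightarrow> real) \<Rightarrow> real ^ 'n \<Rightarrow> real" where
  "D i u x = deriv (\<lambda>t. u (x + t *\<^sub>R axis i 1)) 0"

text \<open>
  Meant for open \<open>S\<close>: all iterated partial derivatives up to order \<open>k\<close> exist and are
  continuous on \<open>S\<close>.
\<close>

fun Ck_on :: "nat \<Rightarrow> (real ^ 'n::finite) set \<Rightarrow> (real ^ 'n \<Rightarrow> real) \<Rightarrow> bool" where
  "Ck_on 0 S u \<longleftrightarrow> continuous_on S u"
| "Ck_on (Suc k) S u \<longleftrightarrow>
     continuous_on S u \<and> (\<forall>i. (\<forall>x\<in>S. has_partial i u x) \<and> Ck_on k S (D i u))"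

definition L_infinity :: "(real ^ 'n::finite \<Rightarrow> real) \<Rightarrow> bool" where
  "L_infinity f \<longleftrightarrow>
     f \<in> borel_measurable lebesgue \<and> (\<exists>C. AE x in lebesgue. \<bar>f x\<bar> \<le> C)"

text \<open>
  The coefficients are \<open>L\<^sup>\<infinity>\<close> functions, so symmetry and ellipticity are only required
  almost everywhere.
\<close>

definition uniformly_elliptic ::
    "real \<Rightarrow> ('n::finite \<Rightarrow> 'n \<Rightarrow> real ^ 'n \<Rightarrow> real) \<Rightarrow> bool" where
  "uniformly_elliptic \<nu> a \<longleftrightarrow>
     0 < \<nu> \<and> \<nu> \<le> 1 \<and>
     (\<forall>i j. L_infinity (a i j)) \<and>
     (\<forall>i j. AE x in lebesgue. a i j x = a j i x) \<and>
     (AE x in lebesgue. \<forall>\<xi>::real ^ 'n.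
        \<nu> * (norm \<xi>)\<^sup>2 \<le> (\<Sum>i\<in>UNIV. \<Sum>j\<in>UNIV. a i j x * \<xi> $ i * \<xi> $ j) \<and>
        (\<Sum>i\<in>UNIV. \<Sum>j\<in>UNIV. a i j x * \<xi> $ i * \<xi> $ j) \<le> inverse \<nu> * (norm \<xi>)\<^sup>2)"

definition L_op ::
    "('n::finite \<Rightarrow> 'n \<Rightarrow> real ^ 'n \<Rightarrow> real) \<Rightarrow> (real ^ 'n \<Rightarrow> real) \<Rightarrow> real ^ 'n \<Rightarrow> real" where
  "L_op a u x = (\<Sum>i\<in>UNIV. \<Sum>j\<in>UNIV. a i j x * D i (D j u) x)"

text \<open>
  The index type \<open>'n\<close> carries no order, so the coordinate called \<open>x\<^sub>n\<close> is an arbitrary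
  distinguished index \<open>k\<close>; \<open>x'\<close> consists of all the other coordinates, and the next
  definition is its Euclidean norm \<open>|x'|\<close>.
\<close>

definition norm_prime :: "'n::finite \<Rightarrow> real ^ 'n \<Rightarrow> real" where
  "norm_prime k x = L2_set (\<lambda>i. x $ i) (UNIV - {k})"

definition Q_set :: "'n::finite \<Rightarrow> real \<Rightarrow> (real \<Rightarrow> real) \<Rightarrow> (real ^ 'n) set" where
  "Q_set k r0 \<psi> =
     {x. norm_prime k x < r0 \<and>
         0 < x $ k - \<psi> (norm_prime k x) \<and> x $ k - \<psi> (norm_prime k x) < r0}"

definition I_int :: "real \<Rightarrow> (real \<Rightarrow> real) \<Rightarrow> ennreal" where
  "I_int r0 \<psi> = (\<integral>\<^sup>+ r\<in>{0<..r0}. ennreal (\<psi> r / r\<^sup>2) \<partial>lborel)"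

end

theory Submission
  imports Defs
begin

text \<open>
  This is a Hopf lemma: below \<open>u\<close> one places a barrier, a function that vanishes at the
  origin, has positive slope there, and satisfies \<open>L v > 0\<close> for every operator \<open>L\<close> with the given
  ellipticity constant. No regularity of the coefficients is available, so the barrier must not
  depend on them; the maximum principle is then the only tool.

  Write \<open>x\<^sub>k\<close> for the distinguished coordinate, \<open>r\<^sub>j = R / 2 ^ j\<close> for dyadic radii and
  \<open>w\<^sub>j = \<psi> r\<^sub>j\<close>. The barrier is \<open>v x = P x\<^sub>k - G \<bar>x\<bar>\<^sup>2\<close> with
  \<open>G s = A s + 10 \<Sum>\<^sub>j w\<^sub>j s / (s + r\<^sub>j\<^sup>2)\<close> and with \<open>P\<close> determined by \<open>P 0 = 0\<close>, \<open>P' 0 = 1\<close> and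
  \<open>P'' t = 2 K G' (t\<^sup>2)\<close>. Three properties make it work.

  \<^item> \<open>G\<close> is concave, so the Hessian of \<open>- G \<bar>x\<bar>\<^sup>2\<close> is at least \<open>- 2 G' \<bar>x\<bar>\<^sup>2\<close> times the identity, where \<open>G'\<close> is
    evaluated at \<open>\<bar>x\<bar>\<^sup>2\<close>.
    Moreover \<open>G'\<close> is decreasing and \<open>x\<^sub>k\<^sup>2 \<le> \<bar>x\<bar>\<^sup>2\<close>, so \<open>P'' x\<^sub>k \<ge> 2 K G' \<bar>x\<bar>\<^sup>2\<close>. Hence the second
    derivative of \<open>v\<close> in a direction \<open>\<xi>\<close> is at least \<open>2 G' \<bar>x\<bar>\<^sup>2 (K \<xi>\<^sub>k\<^sup>2 - \<bar>\<xi>\<bar>\<^sup>2)\<close>, and for large \<open>K\<close> the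
    trace of this quadratic form against any elliptic matrix is positive.

  \<^item> \<open>G r\<^sup>2\<close> exceeds \<open>2 \<psi> r\<close>, because \<open>r\<close> lies in a dyadic interval just below some \<open>r\<^sub>j\<close>, and
    \<open>P t \<le> 2 t\<close>. Hence \<open>v\<close> is not positive at points below the graph of \<open>\<psi>\<close>, and the set where it is
    positive lies in the region where \<open>u\<close> is defined and positive.

  \<^item> The condition \<open>I(\<psi>) < \<infinity>\<close> says that \<open>\<Sum>\<^sub>j w\<^sub>j / r\<^sub>j\<close> converges, and choosing \<open>R\<close> small makes this
    sum small. This gives \<open>t \<le> P t \<le> 2 t\<close>, and it bounds \<open>G \<bar>x\<bar>\<^sup>2\<close> by a small multiple of \<open>\<bar>x\<bar>\<close>, so \<open>v\<close>
    grows linearly along the ray through \<open>l\<close>.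

  Only the first \<open>N\<close> terms of the sums are used. This keeps all functions elementary; the price is
  that the truncated \<open>G\<close> does not dominate \<open>\<psi>\<close> on radii below \<open>r\<^sub>N\<close>. There \<open>v\<close> is at
  most \<open>2 \<psi> r\<^sub>N\<close> below the graph, so one compares \<open>u\<close> with \<open>c (v - \<kappa>)\<close> for \<open>\<kappa> > 2 \<psi> r\<^sub>N\<close>, on the compact set \<open>v \<ge> \<kappa>\<close> in a
  small cylinder. The constant \<open>c\<close> comes from the positive minimum of \<open>u\<close> on a compact part of the
  cylinder's boundary and is independent of \<open>N\<close>, so \<open>\<kappa>\<close> can be taken as small as needed
  (\<open>comparison_with_barrier\<close>).

  If the comparison failed, \<open>u - c v\<close> would have an interior minimum, where the Hessian of \<open>u\<close>
  dominates the form above. The inequality \<open>L u \<le> 0\<close> is known almost everywhere only, but the Hessian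
  is continuous, so at each single point it nearly holds with some elliptic matrix
  (\<open>elliptic_matrix_at_point\<close>). This contradicts the positivity of the trace
  (\<open>no_strictly_elliptic_hessian\<close>).
\<close>

section \<open>Second derivatives from iterated partial derivatives\<close>

lemma has_partial_DERIV:
  assumes "has_partial i u (x + t *\<^sub>R axis i 1)"
  shows "((\<lambda>t. u (x + t *\<^sub>R axis i 1)) has_real_derivative D i u (x + t *\<^sub>R axis i 1)) (at t)"
proof -
  let ?y = "x + t *\<^sub>R axis i 1"
  have "((\<lambda>s. u (?y + s *\<^sub>R axis i 1)) has_real_derivative D i u ?y) (at 0)"
    using assms unfolding has_partial_def D_def
    by (rule field_differentiable_derivI)
  then show ?thesis
    using DERIV_shift[of "\<lambda>t. u (x + t *\<^sub>R axis i 1)" "D i u ?y" 0 t]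
    by (simp add: scaleR_add_left algebra_simps)
qed

text \<open>
  The classical proof that continuous partial derivatives give differentiability moves one coordinate
  at a time and applies the mean value theorem to each move. Restricting the increment to a set \<open>I\<close> of
  coordinates turns this into an induction over finite sets, which avoids enumerating the index type.
\<close>

lemma increment_on_coordinates:
  fixes u :: "real ^ 'n::finite \<Rightarrow> real"
  assumes "open S" "x \<in> S" "\<And>i y. y \<in> S \<Longrightarrow> has_partial i u y"
    and "\<And>i. continuous_on S (D i u)"
    and "finite I" "e > 0"
  shows "\<exists>d>0. \<forall>h. norm h < d \<longrightarrow> (\<forall>i. i \<notin> I \<longrightarrow> h $ i = 0) \<longrightarrow>
           \<bar>u (x + h) - u x - (\<Sum>i\<in>I. D i u x * h $ i)\<bar> \<le> e * norm h"
  using \<open>finite I\<close> \<open>e > 0\<close>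
proof (induction I arbitrary: e rule: finite_induct)
  case empty
  have "\<bar>u (x + h) - u x\<bar> \<le> e * norm h" if "\<forall>i. h $ i = 0" for h
  proof -
    have "h = 0" using that by (simp add: vec_eq_iff)
    then show ?thesis by simp
  qed
  then show ?case by (intro exI[of _ 1]) auto
next
  case (insert k I)
  from insert.IH[of "e/2"] insert.prems obtain d1 where d1: "d1 > 0"
    "\<And>h. norm h < d1 \<Longrightarrow> (\<forall>i. i \<notin> I \<longrightarrow> h $ i = 0) \<Longrightarrow>
       \<bar>u (x + h) - u x - (\<Sum>i\<in>I. D i u x * h $ i)\<bar> \<le> e/2 * norm h"
    by auto
  obtain d0 where d0: "d0 > 0" "ball x d0 \<subseteq> S"
    using assms(1,2) openE by blast
  have "isCont (D k u) x"
    using assms(1,2,4) continuous_on_eq_continuous_at by blast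
  then obtain d2 where d2: "d2 > 0" "\<And>y. dist y x < d2 \<Longrightarrow> dist (D k u y) (D k u x) < e/2"
    using insert.prems unfolding continuous_at_eps_delta by (metis half_gt_zero)
  define d where "d = min d1 (min d0 d2)"
  have "\<bar>u (x + h) - u x - (\<Sum>i\<in>insert k I. D i u x * h $ i)\<bar> \<le> e * norm h"
    if h: "norm h < d" "\<forall>i. i \<notin> insert k I \<longrightarrow> h $ i = 0" for h
  proof -
    \<comment> \<open>The increment without its coordinate \<open>k\<close>; the segment from it to \<open>h\<close> stays in the ball of
        radius \<open>norm h\<close>, where \<open>D k u\<close> is close to its value at \<open>x\<close>.\<close>
    define h' where "h' = h - (h $ k) *\<^sub>R axis k 1"
    have h'_nth: "h' $ i = (if i = k then 0 else h $ i)" for i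
      by (simp add: h'_def axis_def)
    have le: "norm (h' + t *\<^sub>R axis k 1) \<le> norm h" if "\<bar>t\<bar> \<le> \<bar>h $ k\<bar>" for t
      by (rule norm_le_componentwise_cart) (use that in \<open>auto simp: h'_nth axis_def\<close>)
    have nh': "norm h' \<le> norm h" using le[of 0] by simp
    have I: "\<bar>u (x + h') - u x - (\<Sum>i\<in>I. D i u x * h' $ i)\<bar> \<le> e/2 * norm h'"
    proof (rule d1(2))
      show "norm h' < d1" using nh' h(1) by (simp add: d_def)
      show "\<forall>i. i \<notin> I \<longrightarrow> h' $ i = 0" using h(2) by (auto simp: h'_nth)
    qed
    have Ieq: "(\<Sum>i\<in>I. D i u x * h' $ i) = (\<Sum>i\<in>I. D i u x * h $ i)"
      using insert.hyps by (intro sum.cong) (auto simp: h'_nth)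
    let ?g = "\<lambda>t. u (x + h' + t *\<^sub>R axis k 1) - t * D k u x"
    let ?T = "{- \<bar>h $ k\<bar>..\<bar>h $ k\<bar>}"
    have near: "dist (x + h' + t *\<^sub>R axis k 1) x < min d0 d2" if "t \<in> ?T" for t
      using le[of t] that h(1) by (auto simp: dist_norm d_def add.assoc abs_le_iff)
    have der: "(?g has_real_derivative D k u (x + h' + t *\<^sub>R axis k 1) - D k u x) (at t within ?T)"
      if "t \<in> ?T" for t
    proof -
      have "x + h' + t *\<^sub>R axis k 1 \<in> S"
        using near[OF that] d0(2) by (auto simp: dist_commute)
      then have "((\<lambda>t. u (x + h' + t *\<^sub>R axis k 1)) has_real_derivative
            D k u (x + h' + t *\<^sub>R axis k 1)) (at t)"
        by (intro has_partial_DERIV assms(3))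
      from DERIV_diff[OF this DERIV_cmult_right[OF DERIV_ident, of "D k u x"]]
      show ?thesis by (simp add: has_field_derivative_at_within)
    qed
    have "norm (?g (h $ k) - ?g 0) \<le> e/2 * norm (h $ k - 0)"
    proof (rule field_differentiable_bound[where S = ?T])
      show "norm (D k u (x + h' + t *\<^sub>R axis k 1) - D k u x) \<le> e/2" if "t \<in> ?T" for t
        using d2(2)[of "x + h' + t *\<^sub>R axis k 1"] near[OF that] by (auto simp: dist_norm)
    qed (use der in auto)
    moreover have "u (x + h' + h $ k *\<^sub>R axis k 1) = u (x + h)" by (simp add: h'_def)
    ultimately have "\<bar>u (x + h) - u (x + h') - D k u x * h $ k\<bar> \<le> e/2 * \<bar>h $ k\<bar>"
      by (simp add: diff_diff_add add.commute mult.commute)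
    moreover have "e/2 * \<bar>h $ k\<bar> \<le> e/2 * norm h"
      using component_le_norm_cart[of h k] insert.prems by (intro mult_left_mono) auto
    moreover have "e/2 * norm h' \<le> e/2 * norm h"
      using nh' insert.prems by (intro mult_left_mono) auto
    moreover have "(\<Sum>i\<in>insert k I. D i u x * h $ i) = D k u x * h $ k + (\<Sum>i\<in>I. D i u x * h $ i)"
      using insert.hyps by simp
    ultimately show ?thesis
      using I Ieq by argo
  qed
  moreover have "d > 0" using d0 d1 d2 by (simp add: d_def)
  ultimately show ?case by blast
qed

lemma C1_has_derivative:
  fixes u :: "real ^ 'n::finite \<Rightarrow> real"
  assumes "open S" "x \<in> S" "\<And>i y. y \<in> S \<Longrightarrow> has_partial i u y"
    and "\<And>i. continuous_on S (D i u)"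
  shows "(u has_derivative (\<lambda>h. \<Sum>i\<in>UNIV. D i u x * h $ i)) (at x)"
  unfolding has_derivative_at_alt
proof (intro conjI allI impI)
  show "bounded_linear (\<lambda>h. \<Sum>i\<in>UNIV. D i u x * h $ i)"
    by (intro bounded_linear_sum bounded_linear_const_mult bounded_linear_vec_nth)
next
  fix e :: real assume "e > 0"
  then obtain d where d: "d > 0" "\<And>h. norm h < d \<Longrightarrow>
      \<bar>u (x + h) - u x - (\<Sum>i\<in>UNIV. D i u x * h $ i)\<bar> \<le> e * norm h"
    using increment_on_coordinates[OF assms, of UNIV e] by auto
  show "\<exists>d>0. \<forall>y. norm (y - x) < d \<longrightarrow>
      norm (u y - u x - (\<Sum>i\<in>UNIV. D i u x * (y - x) $ i)) \<le> e * norm (y - x)"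
    using d(1) d(2)[of "y - x" for y] by (intro exI[of _ d]) auto
qed

lemma C1_DERIV_line:
  fixes u :: "real ^ 'n::finite \<Rightarrow> real"
  assumes "open S" "x + t *\<^sub>R \<xi> \<in> S" "\<And>i y. y \<in> S \<Longrightarrow> has_partial i u y"
    and "\<And>i. continuous_on S (D i u)"
  shows "((\<lambda>t. u (x + t *\<^sub>R \<xi>)) has_real_derivative
           (\<Sum>i\<in>UNIV. D i u (x + t *\<^sub>R \<xi>) * \<xi> $ i)) (at t)"
proof -
  have "((\<lambda>t. x + t *\<^sub>R \<xi>) has_derivative (\<lambda>s. s *\<^sub>R \<xi>)) (at t)"
    by (auto intro!: derivative_eq_intros)
  from diff_chain_at[OF this C1_has_derivative[OF assms]]
  have "((\<lambda>t. u (x + t *\<^sub>R \<xi>)) has_derivative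
      (\<lambda>s. \<Sum>i\<in>UNIV. D i u (x + t *\<^sub>R \<xi>) * (s *\<^sub>R \<xi>) $ i)) (at t)"
    unfolding o_def .
  then show ?thesis
    by (rule has_derivative_imp_has_field_derivative) (simp add: o_def sum_distrib_left mult_ac)
qed

lemma Ck_on_2D:
  assumes "Ck_on 2 S u"
  shows "y \<in> S \<Longrightarrow> has_partial j u y" and "continuous_on S (D j u)"
    and "y \<in> S \<Longrightarrow> has_partial i (D j u) y" and "continuous_on S (D i (D j u))"
proof -
  have "Ck_on (Suc (Suc 0)) S u" using assms by (simp only: numeral_2_eq_2)
  then show "y \<in> S \<Longrightarrow> has_partial j u y" and "continuous_on S (D j u)"
    and "y \<in> S \<Longrightarrow> has_partial i (D j u) y" and "continuous_on S (D i (D j u))"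
    by simp_all
qed

text \<open>
  The second order condition at a point where \<open>u\<close> along a line is touched from below by a
  one-dimensional function \<open>p\<close>. Using \<open>p\<close> instead of a function on the whole space means that barriers
  have to be differentiated along lines only.
\<close>

lemma second_order_touching:
  fixes u :: "real ^ 'n::finite \<Rightarrow> real"
  assumes "open S" "x \<in> S" "Ck_on 2 S u"
    and p: "\<And>t. (p has_real_derivative p' t) (at t)"
    and p': "(p' has_real_derivative b) (at 0)"
    and touch: "\<forall>\<^sub>F t in nhds 0. u x - p 0 \<le> u (x + t *\<^sub>R \<xi>) - p t"
  shows "b \<le> (\<Sum>i\<in>UNIV. \<Sum>j\<in>UNIV. D i (D j u) x * \<xi> $ i * \<xi> $ j)" (is "b \<le> ?H")
proof (rule ccontr)
  assume neg: "\<not> b \<le> ?H"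
  define g where "g t = u (x + t *\<^sub>R \<xi>) - p t" for t
  define g' where "g' t = (\<Sum>j\<in>UNIV. D j u (x + t *\<^sub>R \<xi>) * \<xi> $ j) - p' t" for t
  obtain d1 where d1: "d1 > 0" "\<And>t. \<bar>t\<bar> < d1 \<Longrightarrow> x + t *\<^sub>R \<xi> \<in> S"
  proof -
    have "((\<lambda>t. x + t *\<^sub>R \<xi>) \<longlongrightarrow> x + 0 *\<^sub>R \<xi>) (nhds 0)"
      by (intro tendsto_intros filterlim_ident)
    then have "\<forall>\<^sub>F t in nhds 0. x + t *\<^sub>R \<xi> \<in> S"
      using assms(1,2) by (auto dest: topological_tendstoD)
    then show ?thesis using that unfolding eventually_nhds_metric dist_real_def by auto
  qed
  have g: "(g has_real_derivative g' t) (at t)" if "\<bar>t\<bar> < d1" for t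
    unfolding g_def g'_def
    by (intro DERIV_diff p C1_DERIV_line[OF \<open>open S\<close>] d1(2) that Ck_on_2D[OF assms(3)])
  have "((\<lambda>t. \<Sum>j\<in>UNIV. D j u (x + t *\<^sub>R \<xi>) * \<xi> $ j) has_real_derivative
      (\<Sum>j\<in>UNIV. (\<Sum>i\<in>UNIV. D i (D j u) (x + 0 *\<^sub>R \<xi>) * \<xi> $ i) * \<xi> $ j)) (at 0)"
    by (intro DERIV_sum DERIV_cmult_right C1_DERIV_line[OF \<open>open S\<close>] Ck_on_2D[OF assms(3)])
       (use assms in auto)
  moreover have "(\<Sum>j\<in>UNIV. (\<Sum>i\<in>UNIV. D i (D j u) (x + 0 *\<^sub>R \<xi>) * \<xi> $ i) * \<xi> $ j) = ?H"
    by (subst sum.swap) (simp add: sum_distrib_right)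
  ultimately have g'': "(g' has_real_derivative ?H - b) (at 0)"
    unfolding g'_def by (metis (no_types, lifting) DERIV_diff p' ext)
  obtain d2 where d2: "d2 > 0" "\<And>t. \<bar>t\<bar> < d2 \<Longrightarrow> g 0 \<le> g t"
    using touch unfolding eventually_nhds_metric dist_real_def g_def by auto
  have "g' 0 = 0"
    using DERIV_local_min[OF g[of 0], of d2] d1 d2 by auto
  then obtain d3 where d3: "d3 > 0" "\<And>t. 0 < t \<Longrightarrow> t < d3 \<Longrightarrow> g' t < 0"
    using DERIV_neg_dec_right[OF g''] neg by auto
  define s where "s = min d1 (min d2 d3) / 2"
  have s: "0 < s" "s < d1" "s < d2" "s < d3" using d1 d2 d3 by (auto simp: s_def)
  obtain z where z: "0 < z" "z < s" "g s - g 0 = (s - 0) * g' z"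
    using MVT2[of 0 s g g'] g s by force
  have "g' z < 0" using d3(2) z s by simp
  then have "g s < g 0" using z s mult_pos_neg[of s "g' z"] by simp
  then show False using d2(2)[of s] s by simp
qed

section \<open>Frozen coefficients and strict subsolutions\<close>

text \<open>
  Lagrange's reduction replaces the usual diagonalisation of \<open>A\<close>, and it works on any finite index set
  by induction: splitting off the square of row \<open>k\<close> divided by \<open>A k k\<close> leaves
  the Schur complement, which is semidefinite on the remaining indices. The split-off part is a
  non-negative multiple of a rank one matrix, whose trace against \<open>B\<close> is a value of the form of \<open>B\<close>.
\<close>

lemma psd_trace_nonneg:
  fixes A B :: "'i \<Rightarrow> 'i \<Rightarrow> real"
  assumes "finite I" "\<And>i j. i \<in> I \<Longrightarrow> j \<in> I \<Longrightarrow> A i j = A j i"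
    and "\<And>z. 0 \<le> (\<Sum>i\<in>I. \<Sum>j\<in>I. A i j * z i * z j)"
    and "\<And>z. 0 \<le> (\<Sum>i\<in>I. \<Sum>j\<in>I. B i j * z i * z j)"
  shows "0 \<le> (\<Sum>i\<in>I. \<Sum>j\<in>I. A i j * B i j)"
  using assms
proof (induction I arbitrary: A rule: finite_induct)
  case empty
  then show ?case by simp
next
  case (insert k I)
  have expand: "(\<Sum>i\<in>insert k I. \<Sum>j\<in>insert k I. f i j) =
      f k k + (\<Sum>j\<in>I. f k j) + (\<Sum>i\<in>I. f i k) + (\<Sum>i\<in>I. \<Sum>j\<in>I. f i j)" for f :: "'i \<Rightarrow> 'i \<Rightarrow> real"
    using insert.hyps by (simp add: sum.distrib)
  have symk: "A i k = A k i" if "i \<in> I" for i using insert.prems(1) that by auto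
  have form: "0 \<le> A k k * s\<^sup>2 + 2 * s * (\<Sum>i\<in>I. A k i * z i) + (\<Sum>i\<in>I. \<Sum>j\<in>I. A i j * z i * z j)"
    for s and z :: "'i \<Rightarrow> real"
  proof -
    let ?w = "z(k := s)"
    have "?w i = z i" if "i \<in> I" for i using that insert.hyps by auto
    then have "(\<Sum>i\<in>insert k I. \<Sum>j\<in>insert k I. A i j * ?w i * ?w j) =
        A k k * s\<^sup>2 + 2 * s * (\<Sum>i\<in>I. A k i * z i) + (\<Sum>i\<in>I. \<Sum>j\<in>I. A i j * z i * z j)"
      unfolding expand
      by (simp add: symk sum_distrib_left power2_eq_square algebra_simps cong: sum.cong)
    then show ?thesis using insert.prems(2)[of ?w] by simp
  qed
  have BI: "0 \<le> (\<Sum>i\<in>I. \<Sum>j\<in>I. B i j * z i * z j)" for z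
  proof -
    have "(if i = k then 0 else z i) = z i" if "i \<in> I" for i using that insert.hyps by auto
    then show ?thesis
      using insert.prems(3)[of "\<lambda>i. if i = k then 0 else z i"] unfolding expand
      by (simp cong: sum.cong)
  qed
  have Akk: "0 \<le> A k k" using form[of 1 "\<lambda>_. 0"] by simp
  show ?case
  proof (cases "A k k = 0")
    case True
    \<comment> \<open>A zero diagonal entry of a semidefinite matrix forces its whole row to vanish.\<close>
    have A0: "A k i = 0" if i: "i \<in> I" for i
    proof (rule ccontr)
      assume n: "A k i \<noteq> 0"
      \<comment> \<open>At this \<open>s\<close> the form takes the value \<open>-1\<close> on \<open>s e\<^sub>k + e\<^sub>i\<close>.\<close>
      define s where "s = - (A i i + 1) / (2 * A k i)"
      let ?z = "\<lambda>j. if j = i then 1 else 0 :: real"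
      have "(\<Sum>j\<in>I. A k j * ?z j) = A k i"
        using insert.hyps i by (simp add: if_distrib[of "\<lambda>t. _ * t"] cong: if_cong)
      moreover have "(\<Sum>i\<in>I. \<Sum>j\<in>I. A i j * ?z i * ?z j) = A i i"
        using insert.hyps i by (simp add: if_distrib[of "\<lambda>t. _ * t"] cong: if_cong)
      ultimately have "0 \<le> 2 * s * A k i + A i i"
        using form[of s ?z] True by simp
      then show False using n by (simp add: s_def field_simps)
    qed
    have "0 \<le> (\<Sum>i\<in>I. \<Sum>j\<in>I. A i j * B i j)"
      using insert.prems(1) form[of 0] BI by (intro insert.IH) auto
    then show ?thesis unfolding expand using True A0 symk by simp
  next
    case False
    with Akk have pos: "A k k > 0" by simp
    define A' where "A' i j = A i j - A k i * A k j / A k k" for i j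
    have sq: "(\<Sum>i\<in>I. \<Sum>j\<in>I. A k i * A k j / A k k * z i * z j) = (\<Sum>i\<in>I. A k i * z i)\<^sup>2 / A k k" for z
      by (simp add: power2_eq_square sum_product sum_divide_distrib mult_ac)
    have psd': "0 \<le> (\<Sum>i\<in>I. \<Sum>j\<in>I. A' i j * z i * z j)" for z
    proof -
      \<comment> \<open>Semidefiniteness of the Schur complement: minimise the form of \<open>A\<close> over the coordinate \<open>k\<close>.\<close>
      define m where "m = (\<Sum>i\<in>I. A k i * z i)"
      have "0 \<le> A k k * (- m / A k k)\<^sup>2 + 2 * (- m / A k k) * m + (\<Sum>i\<in>I. \<Sum>j\<in>I. A i j * z i * z j)"
        unfolding m_def by (rule form)
      also have "\<dots> = (\<Sum>i\<in>I. \<Sum>j\<in>I. A i j * z i * z j) - m\<^sup>2 / A k k"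
        using pos by (simp add: power2_eq_square field_simps)
      also have "\<dots> = (\<Sum>i\<in>I. \<Sum>j\<in>I. A' i j * z i * z j)"
        unfolding m_def sq[symmetric] A'_def by (simp add: left_diff_distrib sum_subtractf)
      finally show ?thesis .
    qed
    have nonneg1: "0 \<le> (\<Sum>i\<in>I. \<Sum>j\<in>I. A' i j * B i j)"
      using insert.prems(1) psd' BI by (intro insert.IH) (auto simp: A'_def)
    have nonneg2: "0 \<le> (\<Sum>i\<in>insert k I. \<Sum>j\<in>insert k I. B i j * A k i * A k j) / A k k"
      using insert.prems(3)[of "A k"] pos by simp
    have split: "(\<Sum>i\<in>I. \<Sum>j\<in>I. A i j * B i j) =
        (\<Sum>i\<in>I. \<Sum>j\<in>I. A' i j * B i j) + (\<Sum>i\<in>I. \<Sum>j\<in>I. B i j * A k i * A k j) / A k k"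
    proof -
      have "A i j * B i j = A' i j * B i j + B i j * A k i * A k j / A k k" for i j
        by (simp add: A'_def algebra_simps)
      then show ?thesis by (simp only: sum.distrib sum_divide_distrib)
    qed
    have row: "(\<Sum>j\<in>I. B k j * A k k * A k j) = A k k * (\<Sum>j\<in>I. A k j * B k j)"
      by (simp add: sum_distrib_left mult_ac)
    have col: "(\<Sum>i\<in>I. B i k * A k i * A k k) = A k k * (\<Sum>i\<in>I. A i k * B i k)"
      by (simp add: sum_distrib_left mult_ac symk)
    have "(\<Sum>i\<in>insert k I. \<Sum>j\<in>insert k I. A i j * B i j) =
        (\<Sum>i\<in>I. \<Sum>j\<in>I. A' i j * B i j) +
        (\<Sum>i\<in>insert k I. \<Sum>j\<in>insert k I. B i j * A k i * A k j) / A k k"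
      unfolding expand add_divide_distrib split row col using pos by simp
    then show ?thesis using nonneg1 nonneg2 by simp
  qed
qed

lemma AE_lebesgue_in_open:
  fixes S :: "'a::euclidean_space set"
  assumes "AE y in lebesgue. P y" "open S" "S \<noteq> {}"
  obtains y where "y \<in> S" "P y"
proof (rule ccontr)
  assume "\<not> thesis"
  with that have "\<And>y. y \<in> S \<Longrightarrow> \<not> P y" by blast
  moreover obtain N where "N \<in> null_sets lebesgue" "{y. \<not> P y} \<subseteq> N"
    using assms(1) by (auto simp: eventually_ae_filter)
  ultimately have "negligible S"
    by (metis (mono_tags, lifting) mem_Collect_eq negligible_iff_null_sets negligible_subset subset_iff)
  then show False using open_not_negligible assms(2,3) by blast
qed

text \<open>
  The differential inequality may fail on a null set, but every neighbourhood of \<open>x\<close> contains a point \<open>y\<close>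
  at which it and all conditions on the coefficients hold. The matrix of coefficients at \<open>y\<close> serves
  for the Hessian at \<open>x\<close>: the coefficients are essentially bounded and the Hessian is continuous, so
  the error is at most \<open>e\<close>.
\<close>

lemma elliptic_matrix_at_point:
  fixes u :: "real ^ 'n::finite \<Rightarrow> real"
  assumes ell: "uniformly_elliptic \<nu> a" and "open \<Omega>" and C2: "Ck_on 2 \<Omega> u"
    and super: "AE x in lebesgue. x \<in> \<Omega> \<longrightarrow> L_op a u x \<le> 0"
    and "x \<in> \<Omega>" "0 < e"
  obtains A where "\<And>i j. A i j = A j i"
    and "\<And>\<xi>::real ^ 'n. \<nu> * (norm \<xi>)\<^sup>2 \<le> (\<Sum>i\<in>UNIV. \<Sum>j\<in>UNIV. A i j * \<xi> $ i * \<xi> $ j)"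
    and "\<And>\<xi>::real ^ 'n. (\<Sum>i\<in>UNIV. \<Sum>j\<in>UNIV. A i j * \<xi> $ i * \<xi> $ j) \<le> inverse \<nu> * (norm \<xi>)\<^sup>2"
    and "(\<Sum>i\<in>UNIV. \<Sum>j\<in>UNIV. A i j * D i (D j u) x) \<le> e"
proof -
  have "\<forall>i j. \<exists>C. AE y in lebesgue. \<bar>a i j y\<bar> \<le> C"
    using ell by (auto simp: uniformly_elliptic_def L_infinity_def)
  then obtain C where C: "\<And>i j. AE y in lebesgue. \<bar>a i j y\<bar> \<le> C i j" by metis
  define M where "M = (\<Sum>i\<in>UNIV. \<Sum>j\<in>UNIV. \<bar>C i j\<bar>) + 1"
  have M: "M > 0" unfolding M_def by (simp add: add_nonneg_pos sum_nonneg)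
  have "\<forall>\<^sub>F y in nhds x. \<bar>D i (D j u) y - D i (D j u) x\<bar> < e / M" for i j
  proof -
    have "isCont (D i (D j u)) x"
      using Ck_on_2D(4)[OF C2] assms(2,5) continuous_on_eq_continuous_at by blast
    then have "(D i (D j u) \<longlongrightarrow> D i (D j u) x) (nhds x)"
      by (simp add: isCont_def tendsto_at_iff_tendsto_nhds)
    from tendstoD[OF this, of "e / M"] show ?thesis
      using M assms(6) by (simp add: dist_real_def)
  qed
  then have "\<forall>\<^sub>F y in nhds x. y \<in> \<Omega> \<and> (\<forall>i j. \<bar>D i (D j u) y - D i (D j u) x\<bar> < e / M)"
    using assms(2,5) by (auto intro!: eventually_conj eventually_all_finite eventually_nhds_in_open)
  then obtain S where S: "open S" "x \<in> S"
    "\<And>y. y \<in> S \<Longrightarrow> y \<in> \<Omega>" "\<And>y i j. y \<in> S \<Longrightarrow> \<bar>D i (D j u) y - D i (D j u) x\<bar> < e / M"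
    unfolding eventually_nhds by blast
  define P where "P y \<longleftrightarrow> (\<forall>i j. \<bar>a i j y\<bar> \<le> C i j) \<and> (\<forall>i j. a i j y = a j i y) \<and>
      (y \<in> \<Omega> \<longrightarrow> L_op a u y \<le> 0) \<and>
      (\<forall>\<xi>::real ^ 'n.
        \<nu> * (norm \<xi>)\<^sup>2 \<le> (\<Sum>i\<in>UNIV. \<Sum>j\<in>UNIV. a i j y * \<xi> $ i * \<xi> $ j) \<and>
        (\<Sum>i\<in>UNIV. \<Sum>j\<in>UNIV. a i j y * \<xi> $ i * \<xi> $ j) \<le> inverse \<nu> * (norm \<xi>)\<^sup>2)" for y
  have "AE y in lebesgue. P y"
    using ell C super unfolding uniformly_elliptic_def P_def
    by (intro eventually_conj eventually_all_finite) auto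
  then obtain y where y: "y \<in> S" "P y"
    using AE_lebesgue_in_open[of P S] S(1,2) by blast
  have "(\<Sum>i\<in>UNIV. \<Sum>j\<in>UNIV. a i j y * D i (D j u) x) - L_op a u y =
      (\<Sum>i\<in>UNIV. \<Sum>j\<in>UNIV. a i j y * (D i (D j u) x - D i (D j u) y))"
    by (simp add: L_op_def right_diff_distrib sum_subtractf)
  also have "\<dots> \<le> (\<Sum>i\<in>UNIV. \<Sum>j\<in>UNIV. \<bar>C i j\<bar> * (e / M))"
  proof (intro sum_mono)
    fix i j
    have "a i j y * (D i (D j u) x - D i (D j u) y) \<le> \<bar>a i j y\<bar> * \<bar>D i (D j u) x - D i (D j u) y\<bar>"
      by (metis abs_ge_self abs_mult)
    also have "\<dots> \<le> \<bar>C i j\<bar> * (e / M)"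
    proof (rule mult_mono)
      show "\<bar>a i j y\<bar> \<le> \<bar>C i j\<bar>"
        using y(2) unfolding P_def by (meson abs_ge_self order_trans)
      show "\<bar>D i (D j u) x - D i (D j u) y\<bar> \<le> e / M"
        using S(4)[OF y(1), of i j] by linarith
    qed auto
    finally show "a i j y * (D i (D j u) x - D i (D j u) y) \<le> \<bar>C i j\<bar> * (e / M)" .
  qed
  also have "\<dots> = (\<Sum>i\<in>UNIV. \<Sum>j\<in>UNIV. \<bar>C i j\<bar>) * (e / M)"
    by (simp only: sum_distrib_right)
  also have "\<dots> = (M - 1) * (e / M)" by (simp add: M_def)
  also have "\<dots> \<le> e" using M assms(6) by (simp add: field_simps)
  finally have "(\<Sum>i\<in>UNIV. \<Sum>j\<in>UNIV. a i j y * D i (D j u) x) \<le> e"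
    using y(2) S(3)[OF y(1)] unfolding P_def by linarith
  then show ?thesis
    using y(2) unfolding P_def by (intro that[of "\<lambda>i j. a i j y"]) auto
qed

text \<open>
  For an elliptic matrix \<open>A\<close> the trace against \<open>K e\<^sub>k e\<^sub>k\<^sup>T - 1\<close> is \<open>K A\<^sub>k\<^sub>k - tr A\<close>, which is at
  least \<open>K \<nu> - n / \<nu>\<close>. A supersolution therefore cannot have a Hessian that dominates a positive
  multiple of this form when \<open>K \<nu> > n / \<nu>\<close>.
\<close>

lemma no_strictly_elliptic_hessian:
  fixes u :: "real ^ 'n::finite \<Rightarrow> real"
  assumes ell: "uniformly_elliptic \<nu> a" and "open \<Omega>" "Ck_on 2 \<Omega> u"
    and "AE x in lebesgue. x \<in> \<Omega> \<longrightarrow> L_op a u x \<le> 0" and "x \<in> \<Omega>"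
    and K: "real CARD('n) * inverse \<nu> < K * \<nu>" "0 \<le> K" and "0 < \<beta>"
    and hess: "\<And>\<xi>. \<beta> * (K * (\<xi> $ k)\<^sup>2 - (norm \<xi>)\<^sup>2) \<le>
      (\<Sum>i\<in>UNIV. \<Sum>j\<in>UNIV. D i (D j u) x * \<xi> $ i * \<xi> $ j)"
  shows False
proof -
  \<comment> \<open>Half of the gap, so that the error of the frozen coefficients cannot close it.\<close>
  define e where "e = \<beta> * (K * \<nu> - real CARD('n) * inverse \<nu>) / 2"
  have e: "0 < e" using K \<open>0 < \<beta>\<close> by (simp add: e_def)
  obtain A where A: "\<And>i j. A i j = A j i"
    "\<And>\<xi>::real ^ 'n. \<nu> * (norm \<xi>)\<^sup>2 \<le> (\<Sum>i\<in>UNIV. \<Sum>j\<in>UNIV. A i j * \<xi> $ i * \<xi> $ j)"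
    "\<And>\<xi>::real ^ 'n. (\<Sum>i\<in>UNIV. \<Sum>j\<in>UNIV. A i j * \<xi> $ i * \<xi> $ j) \<le> inverse \<nu> * (norm \<xi>)\<^sup>2"
    "(\<Sum>i\<in>UNIV. \<Sum>j\<in>UNIV. A i j * D i (D j u) x) \<le> e"
    using elliptic_matrix_at_point[OF assms(1-5) e] by blast
  have diag: "(\<Sum>i\<in>UNIV. \<Sum>j\<in>UNIV. A i j * (axis l 1 :: real ^ 'n) $ i * (axis l 1 :: real ^ 'n) $ j) = A l l" for l
    by (simp add: axis_def if_distrib[of "\<lambda>t. _ * t"] cong: if_cong)
  have Akk: "\<nu> \<le> A k k" using A(2)[of "axis k 1"] diag[of k] by simp
  have "A l l \<le> inverse \<nu>" for l using A(3)[of "axis l 1"] diag[of l] by simp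
  then have tr: "(\<Sum>l\<in>UNIV. A l l) \<le> real CARD('n) * inverse \<nu>"
    using sum_bounded_above[of UNIV "\<lambda>l. A l l" "inverse \<nu>"] by simp
  \<comment> \<open>The non-negative difference of the Hessian and the form in the hypothesis.\<close>
  define B where "B i j = D i (D j u) x -
    \<beta> * (K * (if i = k then if j = k then 1 else 0 else 0) - (if i = j then 1 else 0))" for i j
  have contract: "(\<Sum>i\<in>UNIV. \<Sum>j\<in>UNIV. f i j * B i j) =
      (\<Sum>i\<in>UNIV. \<Sum>j\<in>UNIV. f i j * D i (D j u) x) - \<beta> * (K * f k k - (\<Sum>i\<in>UNIV. f i i))"
    for f :: "'n \<Rightarrow> 'n \<Rightarrow> real"
  proof -
    have "f i j * B i j = f i j * D i (D j u) x -
        (\<beta> * K * (if i = k then if j = k then f i j else 0 else 0) - \<beta> * (if i = j then f i j else 0))"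
      for i j by (simp add: B_def algebra_simps)
    moreover have "(\<Sum>j\<in>UNIV. if i = k then if j = k then f i j else 0 else 0) =
        (if i = k then f k k else 0)" for i
      by (cases "i = k") auto
    ultimately show ?thesis
      by (simp add: sum_subtractf right_diff_distrib flip: sum_distrib_left)
  qed
  have "0 \<le> (\<Sum>i\<in>UNIV. \<Sum>j\<in>UNIV. A i j * B i j)"
  proof (rule psd_trace_nonneg)
    fix z :: "'n \<Rightarrow> real"
    let ?\<xi> = "(\<chi> i. z i) :: real ^ 'n"
    have n: "(norm ?\<xi>)\<^sup>2 = (\<Sum>i\<in>UNIV. (z i)\<^sup>2)"
      unfolding power2_norm_eq_inner by (simp add: inner_vec_def power2_eq_square)
    have "0 \<le> \<nu> * (norm ?\<xi>)\<^sup>2"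
      using ell by (simp add: uniformly_elliptic_def)
    with A(2)[of ?\<xi>] show "0 \<le> (\<Sum>i\<in>UNIV. \<Sum>j\<in>UNIV. A i j * z i * z j)" by simp
    have "(\<Sum>i\<in>UNIV. \<Sum>j\<in>UNIV. B i j * z i * z j) = (\<Sum>i\<in>UNIV. \<Sum>j\<in>UNIV. (z i * z j) * B i j)"
      by (simp add: mult_ac)
    also have "\<dots> = (\<Sum>i\<in>UNIV. \<Sum>j\<in>UNIV. D i (D j u) x * z i * z j) -
        \<beta> * (K * (z k)\<^sup>2 - (\<Sum>i\<in>UNIV. (z i)\<^sup>2))"
      unfolding contract by (simp add: mult_ac power2_eq_square)
    finally show "0 \<le> (\<Sum>i\<in>UNIV. \<Sum>j\<in>UNIV. B i j * z i * z j)"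
      using hess[of ?\<xi>] n by simp
  qed (use A(1) in auto)
  then have "\<beta> * (K * A k k - (\<Sum>i\<in>UNIV. A i i)) \<le> e"
    using A(4) unfolding contract by simp
  moreover have "\<beta> * (K * A k k - (\<Sum>i\<in>UNIV. A i i)) \<ge> \<beta> * (K * \<nu> - real CARD('n) * inverse \<nu>)"
    using tr Akk K(2) \<open>0 < \<beta>\<close> by (intro mult_left_mono diff_mono) auto
  ultimately have "2 * e \<le> e" by (simp add: e_def)
  then show False using e by simp
qed

section \<open>The Dini condition in dyadic form\<close>

lemma dyadic_bracket:
  fixes r R :: real
  assumes "r \<le> R" "R / 2 ^ N < r"
  shows "\<exists>j<N. R / 2 ^ Suc j < r \<and> r \<le> R / 2 ^ j"
  using assms(2)
proof (induction N)
  case 0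
  then show ?case using assms(1) by simp
next
  case (Suc N)
  show ?case
  proof (cases "R / 2 ^ N < r")
    case True
    then show ?thesis using Suc.IH less_Suc_eq by blast
  next
    case False
    then show ?thesis using Suc.prems by (intro exI[of _ N]) simp
  qed
qed

text \<open>
  On \<open>(\<rho>, 2 \<rho>]\<close> the integrand is at least \<open>\<psi> \<rho> / (4 \<rho>\<^sup>2)\<close> by monotonicity, so this interval contributes at
  least a quarter of \<open>\<psi> \<rho> / \<rho>\<close>. These intervals are disjoint for dyadic \<open>\<rho>\<close>, so the contributions add up.
\<close>

lemma dyadic_sum_le_I_int:
  assumes "0 < r0" and nonneg: "\<And>r. r \<in> {0..r0} \<Longrightarrow> 0 \<le> \<psi> r" and mono: "mono_on {0..r0} \<psi>"
    and fin: "I_int r0 \<psi> < \<infinity>"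
  shows "(\<Sum>j<N. \<psi> (r0 / 2 ^ Suc j) / (r0 / 2 ^ Suc j)) \<le> 4 * enn2real (I_int r0 \<psi>)"
proof -
  define \<rho> where "\<rho> j = r0 / 2 ^ Suc j" for j :: nat
  define c where "c j = \<psi> (\<rho> j) / (4 * (\<rho> j)\<^sup>2)" for j
  define J where "J j = {\<rho> j<..2 * \<rho> j}" for j
  have \<rho>: "0 < \<rho> j" "2 * \<rho> j \<le> r0" "\<rho> j \<le> r0" for j
  proof -
    show "0 < \<rho> j" using \<open>0 < r0\<close> by (simp add: \<rho>_def)
    moreover have "r0 / 2 ^ j \<le> r0 / 1" using \<open>0 < r0\<close> by (intro frac_le) auto
    ultimately show "2 * \<rho> j \<le> r0" "\<rho> j \<le> r0" by (auto simp: \<rho>_def)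
  qed
  have c: "0 \<le> c j" for j using nonneg[of "\<rho> j"] \<rho>[of j] by (simp add: c_def)
  have disj: "i = j" if "s \<in> J i" "s \<in> J j" for i j s
  proof -
    have False if "i < j" "s \<in> J i" "s \<in> J j" for i j
    proof -
      have "(2::real) ^ Suc i \<le> 2 ^ j" using that(1) by (intro power_increasing) auto
      then have "2 * \<rho> j \<le> \<rho> i"
        using \<open>0 < r0\<close> by (simp add: \<rho>_def frac_le)
      then show False using that(2,3) by (simp add: J_def)
    qed
    then show ?thesis using that by (metis linorder_neqE_nat)
  qed
  have pt: "(\<Sum>j<N. ennreal (c j) * indicator (J j) s) \<le> ennreal (\<psi> s / s\<^sup>2) * indicator {0<..r0} s" for s
  proof (cases "\<exists>m<N. s \<in> J m")
    case True
    then obtain m where m: "m < N" "s \<in> J m" by blast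
    have s: "\<rho> m < s" "s \<le> 2 * \<rho> m" "0 < s" "s \<le> r0"
      using m(2) \<rho>[of m] by (auto simp: J_def)
    have "(\<Sum>j<N. ennreal (c j) * indicator (J j) s) = (\<Sum>j<N. if j = m then ennreal (c m) else 0)"
      using m(2) disj by (intro sum.cong) (auto simp: indicator_def)
    also have "\<dots> = ennreal (c m)" using m(1) by simp
    also have "c m \<le> \<psi> s / s\<^sup>2"
    proof -
      have "\<psi> (\<rho> m) \<le> \<psi> s" using s \<rho>[of m] by (intro mono_onD[OF mono]) auto
      moreover have "s\<^sup>2 \<le> (2 * \<rho> m)\<^sup>2" using s by (intro power_mono) auto
      ultimately show ?thesis
        unfolding c_def using s \<rho>[of m] nonneg[of "\<rho> m"]
        by (intro frac_le) (auto simp: power_mult_distrib)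
    qed
    finally show ?thesis using s by (simp add: ennreal_leI)
  next
    case False
    then have "(\<Sum>j<N. ennreal (c j) * indicator (J j) s) = 0" by (intro sum.neutral) auto
    then show ?thesis by simp
  qed
  have "ennreal (\<Sum>j<N. c j * \<rho> j) = (\<Sum>j<N. ennreal (c j) * emeasure lborel (J j))"
    using c \<rho>(1) by (simp add: J_def less_imp_le ennreal_mult flip: sum_ennreal)
  also have "\<dots> = (\<integral>\<^sup>+ s. (\<Sum>j<N. ennreal (c j) * indicator (J j) s) \<partial>lborel)"
    by (subst nn_integral_sum) (auto simp: J_def nn_integral_cmult_indicator)
  also have "\<dots> \<le> I_int r0 \<psi>"
    unfolding I_int_def by (intro nn_integral_mono pt)
  also have "I_int r0 \<psi> = ennreal (enn2real (I_int r0 \<psi>))"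
    using fin by simp
  finally have "(\<Sum>j<N. c j * \<rho> j) \<le> enn2real (I_int r0 \<psi>)"
    by (simp only: ennreal_le_iff enn2real_nonneg)
  moreover have "\<psi> (\<rho> j) / \<rho> j = 4 * (c j * \<rho> j)" for j
    using \<rho>[of j] by (simp add: c_def power2_eq_square field_simps)
  ultimately have "(\<Sum>j<N. \<psi> (\<rho> j) / \<rho> j) \<le> 4 * enn2real (I_int r0 \<psi>)"
    by (simp flip: sum_distrib_left)
  then show ?thesis unfolding \<rho>_def .
qed

lemma dyadic_sums_small:
  assumes "0 < r0" and nonneg: "\<And>r. r \<in> {0..r0} \<Longrightarrow> 0 \<le> \<psi> r" and mono: "mono_on {0..r0} \<psi>"
    and fin: "I_int r0 \<psi> < \<infinity>" and "0 < e"
  obtains R where "0 < R" "R < r0" "\<And>N. (\<Sum>j<N. \<psi> (R / 2 ^ j) / (R / 2 ^ j)) \<le> e"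
proof -
  define f where "f j = \<psi> (r0 / 2 ^ Suc j) / (r0 / 2 ^ Suc j)" for j
  have f0: "0 \<le> f j" for j
  proof -
    have "r0 / 2 ^ Suc j \<le> r0 / 1"
      using \<open>0 < r0\<close> by (intro frac_le one_le_power) auto
    then show ?thesis using \<open>0 < r0\<close> nonneg by (simp add: f_def)
  qed
  have "summable f"
  proof (rule bounded_imp_summable[OF f0])
    show "(\<Sum>j\<le>n. f j) \<le> 4 * enn2real (I_int r0 \<psi>)" for n
      using dyadic_sum_le_I_int[OF assms(1-4), of "Suc n"]
      by (simp only: f_def lessThan_Suc_atMost)
  qed
  from suminf_exist_split[OF \<open>0 < e\<close> this] obtain m where m: "norm (\<Sum>i. f (i + m)) < e" by blast
  define R where "R = r0 / 2 ^ Suc m"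
  show ?thesis
  proof
    show "0 < R" using \<open>0 < r0\<close> by (simp add: R_def)
    have "(1::real) < 2 ^ Suc m" by (rule one_less_power) auto
    then show "R < r0" using \<open>0 < r0\<close> by (simp add: R_def divide_less_eq del: power_Suc)
    fix N
    have "(\<Sum>j<N. \<psi> (R / 2 ^ j) / (R / 2 ^ j)) = (\<Sum>j<N. f (j + m))"
      by (simp add: R_def f_def power_add mult_ac)
    also have "\<dots> \<le> (\<Sum>j. f (j + m))"
      using \<open>summable f\<close> f0 by (intro sum_le_suminf) (auto intro: summable_ignore_initial_segment)
    finally show "(\<Sum>j<N. \<psi> (R / 2 ^ j) / (R / 2 ^ j)) \<le> e" using m by simp
  qed
qed

section \<open>The barrier\<close>

lemma norm_prime_sq: "(norm x)\<^sup>2 = (norm_prime k x)\<^sup>2 + (x $ k)\<^sup>2"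
proof -
  have "(norm x)\<^sup>2 = (\<Sum>i\<in>UNIV. (x $ i)\<^sup>2)"
    unfolding power2_norm_eq_inner by (simp add: inner_vec_def power2_eq_square)
  also have "\<dots> = (x $ k)\<^sup>2 + (\<Sum>i\<in>UNIV - {k}. (x $ i)\<^sup>2)"
    by (simp add: sum.remove)
  finally show ?thesis
    by (simp add: norm_prime_def L2_set_def sum_nonneg)
qed

lemma norm_prime_nonneg: "0 \<le> norm_prime k x"
  by (simp add: norm_prime_def L2_set_nonneg)

lemma norm_prime_le_norm: "norm_prime k x \<le> norm x"
  by (rule power2_le_imp_le) (simp_all add: norm_prime_sq[of x k])

lemma norm_le_norm_prime: "norm x \<le> norm_prime k x + \<bar>x $ k\<bar>"
proof (rule power2_le_imp_le)
  show "(norm x)\<^sup>2 \<le> (norm_prime k x + \<bar>x $ k\<bar>)\<^sup>2"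
    using norm_prime_nonneg[of k x] by (simp add: norm_prime_sq[of x k] power2_sum)
  show "0 \<le> norm_prime k x + \<bar>x $ k\<bar>"
    using norm_prime_nonneg[of k x] by simp
qed

lemma continuous_on_norm_prime: "continuous_on S (norm_prime k)"
  unfolding norm_prime_def L2_set_def
  by (intro continuous_intros)

text \<open>
  The barrier is \<open>vertical_part\<close> at \<open>x\<^sub>k\<close> minus \<open>radial_part\<close> at \<open>\<bar>x\<bar>\<^sup>2\<close>. Each summand \<open>s / (s + \<rho>\<^sup>2)\<close> is a smooth
  concave substitute for \<open>min 1 (s / \<rho>\<^sup>2)\<close>. The function \<open>t arctan (t / \<rho>) / \<rho>\<close> is chosen because
  its second derivative is \<open>2 \<rho>\<^sup>2 / (t\<^sup>2 + \<rho>\<^sup>2)\<^sup>2\<close>, twice the derivative of \<open>s / (s + \<rho>\<^sup>2)\<close> at \<open>s = t\<^sup>2\<close>, while it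
  still grows only linearly.
\<close>

definition radial_part :: "real \<Rightarrow> (nat \<Rightarrow> real) \<Rightarrow> (nat \<Rightarrow> real) \<Rightarrow> nat \<Rightarrow> real \<Rightarrow> real" where
  "radial_part A w \<rho> N s = A * s + 10 * (\<Sum>j<N. w j * (s / (s + (\<rho> j)\<^sup>2)))"

definition vertical_part :: "real \<Rightarrow> real \<Rightarrow> (nat \<Rightarrow> real) \<Rightarrow> (nat \<Rightarrow> real) \<Rightarrow> nat \<Rightarrow> real \<Rightarrow> real" where
  "vertical_part K A w \<rho> N t =
     t + K * A * t\<^sup>2 + 10 * K * (\<Sum>j<N. w j * (t * arctan (t / \<rho> j) / \<rho> j))"

definition radial_slope :: "real \<Rightarrow> (nat \<Rightarrow> real) \<Rightarrow> (nat \<Rightarrow> real) \<Rightarrow> nat \<Rightarrow> real \<Rightarrow> real" where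
  "radial_slope A w \<rho> N s = A + 10 * (\<Sum>j<N. w j * ((\<rho> j)\<^sup>2 / (s + (\<rho> j)\<^sup>2)\<^sup>2))"

definition vertical_slope :: "real \<Rightarrow> real \<Rightarrow> (nat \<Rightarrow> real) \<Rightarrow> (nat \<Rightarrow> real) \<Rightarrow> nat \<Rightarrow> real \<Rightarrow> real" where
  "vertical_slope K A w \<rho> N t = 1 + K * A * (2 * t) + 10 * K *
     (\<Sum>j<N. w j * ((arctan (t / \<rho> j) + t * \<rho> j / (t\<^sup>2 + (\<rho> j)\<^sup>2)) / \<rho> j))"

lemma radial_part_DERIV:
  assumes "\<And>j. 0 < \<rho> j" "0 \<le> s"
  shows "(radial_part A w \<rho> N has_real_derivative radial_slope A w \<rho> N s) (at s)"
proof -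
  have each: "((\<lambda>s. s / (s + r\<^sup>2)) has_real_derivative r\<^sup>2 / (s + r\<^sup>2)\<^sup>2) (at s)" if "0 < r" for r :: real
  proof -
    have "s + r\<^sup>2 \<noteq> 0" using that assms(2) by (smt (verit) zero_less_power)
    then show ?thesis
      by (auto intro!: derivative_eq_intros simp: power2_eq_square)
  qed
  have "((\<lambda>s. A * s + 10 * (\<Sum>j<N. w j * (s / (s + (\<rho> j)\<^sup>2)))) has_real_derivative
      A * 1 + 10 * (\<Sum>j<N. w j * ((\<rho> j)\<^sup>2 / (s + (\<rho> j)\<^sup>2)\<^sup>2))) (at s)"
    by (intro DERIV_add DERIV_cmult DERIV_sum DERIV_ident each assms(1))
  then show ?thesis by (simp add: radial_part_def[abs_def] radial_slope_def)
qed

lemma radial_slope_DERIV: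
  assumes "\<And>j. 0 < \<rho> j" "\<And>j. 0 \<le> w j" "0 \<le> s"
  shows "\<exists>g\<le>0. (radial_slope A w \<rho> N has_real_derivative g) (at s)"
proof (intro exI conjI)
  have each: "((\<lambda>s. r\<^sup>2 / (s + r\<^sup>2)\<^sup>2) has_real_derivative - (2 * r\<^sup>2 / (s + r\<^sup>2) ^ 3)) (at s)"
    if "0 < r" for r :: real
  proof -
    have "s + r\<^sup>2 \<noteq> 0" using that assms(3) by (smt (verit) zero_less_power)
    then show ?thesis
      by (auto intro!: derivative_eq_intros simp: divide_simps)
         (simp add: power2_eq_square power3_eq_cube power4_eq_xxxx algebra_simps)
  qed
  have "((\<lambda>s. A + 10 * (\<Sum>j<N. w j * ((\<rho> j)\<^sup>2 / (s + (\<rho> j)\<^sup>2)\<^sup>2))) has_real_derivative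
      0 + 10 * (\<Sum>j<N. w j * (- (2 * (\<rho> j)\<^sup>2 / (s + (\<rho> j)\<^sup>2) ^ 3)))) (at s)"
    by (intro DERIV_add DERIV_cmult DERIV_sum DERIV_const each assms(1))
  then show "(radial_slope A w \<rho> N has_real_derivative
      10 * (\<Sum>j<N. w j * (- (2 * (\<rho> j)\<^sup>2 / (s + (\<rho> j)\<^sup>2) ^ 3)))) (at s)"
    by (simp add: radial_slope_def[abs_def])
  show "10 * (\<Sum>j<N. w j * (- (2 * (\<rho> j)\<^sup>2 / (s + (\<rho> j)\<^sup>2) ^ 3))) \<le> 0"
    using assms(2,3) by (simp add: sum_nonpos mult_nonneg_nonpos2 sum_negf sum_nonneg)
qed

lemma vertical_part_DERIV:
  assumes "\<And>j. 0 < \<rho> j"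
  shows "(vertical_part K A w \<rho> N has_real_derivative vertical_slope K A w \<rho> N t) (at t)"
proof -
  have each: "((\<lambda>t. t * arctan (t / r) / r) has_real_derivative (arctan (t / r) + t * r / (t\<^sup>2 + r\<^sup>2)) / r) (at t)"
    if "0 < r" for r :: real
  proof -
    have "((\<lambda>t. t * arctan (t / r) / r) has_real_derivative
        (arctan (t / r) + t * (inverse (1 + (t / r)\<^sup>2) * (1 / r))) / r) (at t)"
      using that by (auto intro!: derivative_eq_intros)
    moreover have "t * (inverse (1 + (t / r)\<^sup>2) * (1 / r)) = t * r / (t\<^sup>2 + r\<^sup>2)"
    proof -
      have "1 + (t / r)\<^sup>2 = (t\<^sup>2 + r\<^sup>2) / r\<^sup>2" using that by (simp add: field_simps)
      then show ?thesis using that by (simp add: power2_eq_square)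
    qed
    ultimately show ?thesis by simp
  qed
  have sq: "((\<lambda>t. t\<^sup>2) has_real_derivative 2 * t) (at t)"
    by (auto intro!: derivative_eq_intros)
  have "((\<lambda>t. t + K * A * t\<^sup>2 + 10 * K * (\<Sum>j<N. w j * (t * arctan (t / \<rho> j) / \<rho> j))) has_real_derivative
      1 + K * A * (2 * t) + 10 * K *
        (\<Sum>j<N. w j * ((arctan (t / \<rho> j) + t * \<rho> j / (t\<^sup>2 + (\<rho> j)\<^sup>2)) / \<rho> j))) (at t)"
    by (intro DERIV_add DERIV_cmult DERIV_sum DERIV_ident each sq assms(1))
  then show ?thesis by (simp only: vertical_part_def[abs_def] vertical_slope_def)
qed

text \<open>
  The point of the choice of the arctangents: it makes the second derivative of the vertical part a
  value of \<open>G'\<close>, so the two parts of the barrier can be compared through the monotonicity of \<open>G'\<close> alone,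
  for all radii \<open>\<rho>\<^sub>j\<close> at once.
\<close>

lemma vertical_slope_DERIV:
  assumes "\<And>j. 0 < \<rho> j"
  shows "(vertical_slope K A w \<rho> N has_real_derivative 2 * K * radial_slope A w \<rho> N (t\<^sup>2)) (at t)"
proof -
  have each: "((\<lambda>t. (arctan (t / r) + t * r / (t\<^sup>2 + r\<^sup>2)) / r) has_real_derivative
      2 * (r\<^sup>2 / (t\<^sup>2 + r\<^sup>2)\<^sup>2)) (at t)" if "0 < r" for r :: real
  proof -
    have pos: "0 < t\<^sup>2 + r\<^sup>2" using that by (simp add: add_nonneg_pos)
    have "((\<lambda>t. arctan (t / r)) has_real_derivative r / (t\<^sup>2 + r\<^sup>2)) (at t)"
    proof -
      have "((\<lambda>t. arctan (t / r)) has_real_derivative inverse (1 + (t / r)\<^sup>2) * (1 / r)) (at t)"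
        using that by (auto intro!: derivative_eq_intros)
      moreover have "1 + (t / r)\<^sup>2 = (t\<^sup>2 + r\<^sup>2) / r\<^sup>2" using that by (simp add: field_simps)
      ultimately show ?thesis using that by (simp add: power2_eq_square)
    qed
    moreover have "((\<lambda>t. t * r / (t\<^sup>2 + r\<^sup>2)) has_real_derivative
        (r * (t\<^sup>2 + r\<^sup>2) - t * r * (2 * t)) / (t\<^sup>2 + r\<^sup>2)\<^sup>2) (at t)"
      using pos by (auto intro!: derivative_eq_intros simp: power2_eq_square)
    ultimately have "((\<lambda>t. (arctan (t / r) + t * r / (t\<^sup>2 + r\<^sup>2)) / r) has_real_derivative
        (r / (t\<^sup>2 + r\<^sup>2) + (r * (t\<^sup>2 + r\<^sup>2) - t * r * (2 * t)) / (t\<^sup>2 + r\<^sup>2)\<^sup>2) / r) (at t)"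
      by (intro DERIV_cdivide DERIV_add)
    moreover have "(r / (t\<^sup>2 + r\<^sup>2) + (r * (t\<^sup>2 + r\<^sup>2) - t * r * (2 * t)) / (t\<^sup>2 + r\<^sup>2)\<^sup>2) / r
        = 2 * (r\<^sup>2 / (t\<^sup>2 + r\<^sup>2)\<^sup>2)"
    proof -
      have "r / (t\<^sup>2 + r\<^sup>2) = r * (t\<^sup>2 + r\<^sup>2) / (t\<^sup>2 + r\<^sup>2)\<^sup>2"
        using pos by (simp add: power2_eq_square)
      then have "r / (t\<^sup>2 + r\<^sup>2) + (r * (t\<^sup>2 + r\<^sup>2) - t * r * (2 * t)) / (t\<^sup>2 + r\<^sup>2)\<^sup>2 =
          (r * (t\<^sup>2 + r\<^sup>2) + (r * (t\<^sup>2 + r\<^sup>2) - t * r * (2 * t))) / (t\<^sup>2 + r\<^sup>2)\<^sup>2"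
        by (simp only: add_divide_distrib)
      also have "\<dots> = r * (2 * (r\<^sup>2 / (t\<^sup>2 + r\<^sup>2)\<^sup>2))"
        by (simp add: power2_eq_square algebra_simps)
      finally show ?thesis using that by simp
    qed
    ultimately show ?thesis by simp
  qed
  have "((\<lambda>t. 1 + K * A * (2 * t) + 10 * K *
     (\<Sum>j<N. w j * ((arctan (t / \<rho> j) + t * \<rho> j / (t\<^sup>2 + (\<rho> j)\<^sup>2)) / \<rho> j))) has_real_derivative
      0 + K * A * (2 * 1) + 10 * K * (\<Sum>j<N. w j * (2 * ((\<rho> j)\<^sup>2 / (t\<^sup>2 + (\<rho> j)\<^sup>2)\<^sup>2)))) (at t)"
    by (intro DERIV_add DERIV_cmult DERIV_sum DERIV_ident DERIV_const each assms(1))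
  moreover have "(\<Sum>j<N. w j * (2 * ((\<rho> j)\<^sup>2 / (t\<^sup>2 + (\<rho> j)\<^sup>2)\<^sup>2))) =
      2 * (\<Sum>j<N. w j * ((\<rho> j)\<^sup>2 / (t\<^sup>2 + (\<rho> j)\<^sup>2)\<^sup>2))"
    by (simp add: sum_distrib_left mult_ac)
  then have "0 + K * A * (2 * 1) + 10 * K * (\<Sum>j<N. w j * (2 * ((\<rho> j)\<^sup>2 / (t\<^sup>2 + (\<rho> j)\<^sup>2)\<^sup>2))) =
      2 * K * radial_slope A w \<rho> N (t\<^sup>2)"
    unfolding radial_slope_def by (simp add: algebra_simps)
  ultimately show ?thesis by (simp only: vertical_slope_def[abs_def])
qed

lemma radial_slope_antimono:
  assumes "\<And>j. 0 < \<rho> j" "\<And>j. 0 \<le> w j" "0 \<le> s" "s \<le> s'"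
  shows "radial_slope A w \<rho> N s' \<le> radial_slope A w \<rho> N s"
proof -
  have "(\<rho> j)\<^sup>2 / (s' + (\<rho> j)\<^sup>2)\<^sup>2 \<le> (\<rho> j)\<^sup>2 / (s + (\<rho> j)\<^sup>2)\<^sup>2" for j
    using assms(1)[of j] assms(3,4) by (intro frac_le power_mono zero_less_power add_nonneg_pos) auto
  then show ?thesis
    unfolding radial_slope_def using assms(2) by (intro add_mono mult_left_mono sum_mono) auto
qed

lemma radial_slope_ge:
  assumes "\<And>j. 0 \<le> w j" shows "A \<le> radial_slope A w \<rho> N s"
  unfolding radial_slope_def using assms by (simp add: sum_nonneg)

text \<open>
  Along a line through \<open>x\<close> in direction \<open>\<xi>\<close> the second derivative of the barrier is
  \<open>P'' \<xi>\<^sub>k\<^sup>2 - 2 G' \<bar>\<xi>\<bar>\<^sup>2 - 4 G'' (x \<bullet> \<xi>)\<^sup>2\<close>. The last term helps since \<open>G\<close> is concave, and the first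
  is at least \<open>2 K G' \<xi>\<^sub>k\<^sup>2\<close> since \<open>G'\<close> is decreasing and \<open>x\<^sub>k\<^sup>2 \<le> \<bar>x\<bar>\<^sup>2\<close>. At a touching point the Hessian of
  \<open>u\<close> inherits the bound.
\<close>

lemma hessian_above_touching_barrier:
  fixes u :: "real ^ 'n::finite \<Rightarrow> real"
  assumes "open \<Omega>" "x \<in> \<Omega>" "Ck_on 2 \<Omega> u"
    and \<rho>: "\<And>j. 0 < \<rho> j" and w: "\<And>j. 0 \<le> w j" and "0 \<le> c" "0 \<le> K"
    and v: "\<And>y. v y = vertical_part K A w \<rho> N (y $ k) - radial_part A w \<rho> N (y \<bullet> y)"
    and touch: "\<forall>\<^sub>F y in nhds x. u x - c * v x \<le> u y - c * v y"
  shows "2 * c * radial_slope A w \<rho> N (x \<bullet> x) * (K * (\<xi> $ k)\<^sup>2 - (norm \<xi>)\<^sup>2) \<le>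
     (\<Sum>i\<in>UNIV. \<Sum>j\<in>UNIV. D i (D j u) x * \<xi> $ i * \<xi> $ j)"
proof -
  define s where "s t = (x + t *\<^sub>R \<xi>) \<bullet> (x + t *\<^sub>R \<xi>)" for t
  define s' where "s' t = 2 * (x \<bullet> \<xi>) + 2 * t * (\<xi> \<bullet> \<xi>)" for t
  define z where "z t = x $ k + t * \<xi> $ k" for t
  have s_eq: "s t = x \<bullet> x + 2 * t * (x \<bullet> \<xi>) + t\<^sup>2 * (\<xi> \<bullet> \<xi>)" for t
    by (simp add: s_def inner_left_distrib inner_right_distrib inner_commute power2_eq_square algebra_simps)
  have s: "(s has_real_derivative s' t) (at t)" for t
    unfolding s_eq[abs_def] s'_def by (auto intro!: derivative_eq_intros)
  have s': "(s' has_real_derivative 2 * (\<xi> \<bullet> \<xi>)) (at t)" for t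
    unfolding s'_def[abs_def] by (auto intro!: derivative_eq_intros)
  have z: "(z has_real_derivative \<xi> $ k) (at t)" for t
    unfolding z_def[abs_def] by (auto intro!: derivative_eq_intros)
  have s0: "0 \<le> s t" for t by (simp add: s_def)
  let ?P = "vertical_part K A w \<rho> N" and ?P' = "vertical_slope K A w \<rho> N"
  let ?G = "radial_part A w \<rho> N" and ?G' = "radial_slope A w \<rho> N"
  obtain g where g: "g \<le> 0" "(?G' has_real_derivative g) (at (s 0))"
    using radial_slope_DERIV[where \<rho> = \<rho> and w = w and s = "s 0" and A = A and N = N, OF \<rho> w s0] by blast
  define p where "p t = c * (?P (z t) - ?G (s t))" for t
  define p' where "p' t = c * (?P' (z t) * \<xi> $ k - ?G' (s t) * s' t)" for t
  have p: "(p has_real_derivative p' t) (at t)" for t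
    unfolding p_def[abs_def] p'_def
    by (intro DERIV_cmult DERIV_diff DERIV_chain2[OF vertical_part_DERIV[where \<rho> = \<rho>, OF \<rho>] z]
        DERIV_chain2[OF radial_part_DERIV[where \<rho> = \<rho>, OF \<rho> s0] s])
  have p': "(p' has_real_derivative
      c * (2 * K * ?G' ((z 0)\<^sup>2) * \<xi> $ k * \<xi> $ k - (?G' (s 0) * (2 * (\<xi> \<bullet> \<xi>)) + g * s' 0 * s' 0))) (at 0)"
    unfolding p'_def[abs_def]
    by (intro DERIV_cmult DERIV_diff DERIV_cmult_right DERIV_mult' DERIV_chain2[OF g(2) s] s'
        DERIV_chain2[OF vertical_slope_DERIV[where \<rho> = \<rho>, OF \<rho>] z])
  have "((\<lambda>t. x + t *\<^sub>R \<xi>) \<longlongrightarrow> x + 0 *\<^sub>R \<xi>) (nhds 0)"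
    by (intro tendsto_intros filterlim_ident)
  then have "filterlim (\<lambda>t. x + t *\<^sub>R \<xi>) (nhds x) (nhds 0)" by simp
  then have "\<forall>\<^sub>F t in nhds 0. u x - c * v x \<le> u (x + t *\<^sub>R \<xi>) - c * v (x + t *\<^sub>R \<xi>)"
    using touch by (rule eventually_compose_filterlim[rotated])
  then have tch: "\<forall>\<^sub>F t in nhds 0. u x - p 0 \<le> u (x + t *\<^sub>R \<xi>) - p t"
    by (simp add: v p_def z_def s_def)
  have "2 * c * ?G' (s 0) * (K * (\<xi> $ k)\<^sup>2 - (norm \<xi>)\<^sup>2) \<le>
      c * (2 * K * ?G' ((z 0)\<^sup>2) * \<xi> $ k * \<xi> $ k - (?G' (s 0) * (2 * (\<xi> \<bullet> \<xi>)) + g * s' 0 * s' 0))"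
  proof -
    have "(x $ k)\<^sup>2 \<le> x \<bullet> x"
      using norm_prime_sq[of x k] by (simp add: power2_norm_eq_inner)
    then have "?G' (s 0) \<le> ?G' ((z 0)\<^sup>2)"
      using \<rho> w by (intro radial_slope_antimono) (auto simp: z_def s_def)
    then have "?G' (s 0) * (2 * K * (\<xi> $ k)\<^sup>2) \<le> ?G' ((z 0)\<^sup>2) * (2 * K * (\<xi> $ k)\<^sup>2)"
      using \<open>0 \<le> K\<close> by (intro mult_right_mono) auto
    moreover have "g * s' 0 * s' 0 \<le> 0"
      using g(1) by (simp add: mult.assoc mult_nonpos_nonneg)
    ultimately have "2 * ?G' (s 0) * (K * (\<xi> $ k)\<^sup>2 - (norm \<xi>)\<^sup>2) \<le>
      2 * K * ?G' ((z 0)\<^sup>2) * \<xi> $ k * \<xi> $ k - (?G' (s 0) * (2 * (\<xi> \<bullet> \<xi>)) + g * s' 0 * s' 0)"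
      unfolding power2_norm_eq_inner by (simp add: power2_eq_square algebra_simps)
    from mult_left_mono[OF this \<open>0 \<le> c\<close>] show ?thesis by (simp add: mult_ac)
  qed
  also have "\<dots> \<le> (\<Sum>i\<in>UNIV. \<Sum>j\<in>UNIV. D i (D j u) x * \<xi> $ i * \<xi> $ j)"
    by (rule second_order_touching[OF assms(1-3) p p' tch])
  finally show ?thesis by (simp add: s_def)
qed

lemma vertical_part_bounds:
  assumes "\<And>j. 0 < \<rho> j" "\<And>j. 0 \<le> w j" "0 \<le> K" "0 \<le> A" "0 \<le> t" "t \<le> R"
    and "K * A * R \<le> 1 / 2" "(\<Sum>j<N. w j / \<rho> j) \<le> e" "40 * K * e \<le> 1"
  shows "t \<le> vertical_part K A w \<rho> N t" "vertical_part K A w \<rho> N t \<le> 2 * t"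
proof -
  let ?S = "\<Sum>j<N. w j * (t * arctan (t / \<rho> j) / \<rho> j)"
  have at: "0 \<le> arctan (t / \<rho> j)" "arctan (t / \<rho> j) \<le> 2" for j
    using assms(1)[of j] \<open>0 \<le> t\<close> arctan_ubound[of "t / \<rho> j"] pi_less_4
    by (auto simp: less_imp_le)
  have S0: "0 \<le> ?S"
    using assms(1,2) at(1) \<open>0 \<le> t\<close>
    by (intro sum_nonneg mult_nonneg_nonneg divide_nonneg_nonneg) (auto intro: less_imp_le)
  then show "t \<le> vertical_part K A w \<rho> N t"
    using assms(3,4) by (simp add: vertical_part_def)
  have "?S \<le> (\<Sum>j<N. 2 * t * (w j / \<rho> j))"
  proof (rule sum_mono)
    fix j
    have "t * arctan (t / \<rho> j) * (w j / \<rho> j) \<le> t * 2 * (w j / \<rho> j)"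
      using at(2)[of j] \<open>0 \<le> t\<close> assms(1)[of j] assms(2)[of j]
      by (intro mult_right_mono mult_left_mono) auto
    then show "w j * (t * arctan (t / \<rho> j) / \<rho> j) \<le> 2 * t * (w j / \<rho> j)"
      by (simp add: mult_ac)
  qed
  also have "\<dots> \<le> 2 * t * e"
    unfolding sum_distrib_left[symmetric] using assms(8) \<open>0 \<le> t\<close> by (intro mult_left_mono) auto
  finally have "10 * K * ?S \<le> 10 * K * (2 * t * e)"
    using assms(3) by (intro mult_left_mono) auto
  also have "\<dots> = (40 * K * e) * (t / 2)" by simp
  also have "\<dots> \<le> 1 * (t / 2)" using assms(5,9) by (intro mult_right_mono) auto
  finally have "10 * K * ?S \<le> t / 2" by simp
  moreover have "K * A * t\<^sup>2 \<le> t / 2"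
  proof -
    have "K * A * t \<le> K * A * R" using assms(3-6) by (intro mult_left_mono) auto
    then have "K * A * t * t \<le> 1 / 2 * t" using assms(5,7) by (intro mult_right_mono) auto
    then show ?thesis by (simp add: power2_eq_square mult_ac)
  qed
  ultimately show "vertical_part K A w \<rho> N t \<le> 2 * t" by (simp add: vertical_part_def)
qed

text \<open>
  The term of radius \<open>\<rho>\<close> is at most \<open>\<tau> / (2 \<rho>)\<close> by the inequality of the means, whatever the ratio of
  \<open>\<tau>\<close> and \<open>\<rho>\<close>; the Dini sum then bounds the total linearly in \<open>\<tau>\<close>.
\<close>

lemma radial_part_le:
  assumes "\<And>j. 0 < \<rho> j" "\<And>j. 0 \<le> w j" "0 \<le> \<tau>" "(\<Sum>j<N. w j / \<rho> j) \<le> e"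
  shows "radial_part A w \<rho> N (\<tau>\<^sup>2) \<le> A * \<tau>\<^sup>2 + 5 * \<tau> * e"
proof -
  have "(\<Sum>j<N. w j * (\<tau>\<^sup>2 / (\<tau>\<^sup>2 + (\<rho> j)\<^sup>2))) \<le> (\<Sum>j<N. \<tau> / 2 * (w j / \<rho> j))"
  proof (rule sum_mono)
    fix j
    have "2 * \<tau> * \<rho> j \<le> \<tau>\<^sup>2 + (\<rho> j)\<^sup>2"
      using sum_squares_bound[of \<tau> "\<rho> j"] by simp
    then have "\<tau> * (2 * \<tau> * \<rho> j) \<le> \<tau> * (\<tau>\<^sup>2 + (\<rho> j)\<^sup>2)"
      using assms(3) by (rule mult_left_mono)
    then have "\<tau>\<^sup>2 / (\<tau>\<^sup>2 + (\<rho> j)\<^sup>2) \<le> \<tau> / (2 * \<rho> j)"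
      using assms(1)[of j] by (simp add: divide_simps add_nonneg_pos power2_eq_square mult_ac)
    from mult_left_mono[OF this assms(2)[of j]]
    show "w j * (\<tau>\<^sup>2 / (\<tau>\<^sup>2 + (\<rho> j)\<^sup>2)) \<le> \<tau> / 2 * (w j / \<rho> j)" by (simp add: mult_ac)
  qed
  also have "\<dots> \<le> \<tau> / 2 * e"
    unfolding sum_distrib_left[symmetric] using assms(3,4) by (intro mult_left_mono) auto
  finally show ?thesis by (simp add: radial_part_def)
qed

text \<open>
  For a distance \<open>\<tau> \<ge> \<rho>\<^sub>j / 2\<close> the single term of index \<open>j\<close> already contributes \<open>10 w\<^sub>j / 5\<close>.
\<close>

lemma radial_part_ge:
  assumes "\<And>j. 0 < \<rho> j" "\<And>j. 0 \<le> w j" "j < N" "\<rho> j / 2 \<le> \<tau>" "\<tau>\<^sup>2 \<le> s"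
  shows "A * s + 2 * w j \<le> radial_part A w \<rho> N s"
proof -
  have "(\<rho> j / 2)\<^sup>2 \<le> \<tau>\<^sup>2" using assms(1)[of j] assms(4) by (intro power_mono) auto
  then have "(\<rho> j / 2)\<^sup>2 \<le> s" using assms(5) by (rule order_trans)
  then have s: "(\<rho> j)\<^sup>2 \<le> 4 * s" by (simp add: power_divide)
  moreover have "0 < (\<rho> j)\<^sup>2" using assms(1)[of j] by simp
  ultimately have s0: "0 \<le> s" "0 < s + (\<rho> j)\<^sup>2" by linarith+
  have "1 / 5 \<le> s / (s + (\<rho> j)\<^sup>2)" using s s0 by (simp add: pos_le_divide_eq)
  then have "w j * (1 / 5) \<le> w j * (s / (s + (\<rho> j)\<^sup>2))" using assms(2) by (rule mult_left_mono)
  also have "\<dots> \<le> (\<Sum>j<N. w j * (s / (s + (\<rho> j)\<^sup>2)))"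
    using assms(2,3) s0(1) by (intro member_le_sum) auto
  finally show ?thesis by (simp add: radial_part_def)
qed

section \<open>Comparison and growth at the boundary point\<close>

text \<open>
  The comparison takes place on the part of the cylinder \<open>\<bar>x'\<bar> \<le> R\<close>, \<open>0 \<le> x\<^sub>k \<le> R\<close> where \<open>v \<ge> \<kappa>\<close>. This set is
  compact and lies strictly above the graph of \<open>\<psi>\<close>; it is described by continuous functions, whereas
  \<open>\<psi>\<close> may jump, so that the region above its graph may fail to be open. On its relative
  boundary \<open>v = \<kappa>\<close> the comparison is trivial. The rest of its boundary lies on the top and the side
  of the cylinder, inside a compact set \<open>\<Gamma>\<close> that does not depend on \<open>N\<close>: the term \<open>A \<bar>x\<bar>\<^sup>2\<close> of the barrier
  makes \<open>v\<close> negative on the side up to a fixed height above the graph. On \<open>\<Gamma>\<close> the function \<open>u\<close> has a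
  positive minimum, which determines \<open>c\<close>.
\<close>

lemma comparison_with_barrier:
  fixes u :: "real ^ 'n::finite \<Rightarrow> real"
  assumes "open \<Omega>" and C2: "Ck_on 2 \<Omega> u" and ell: "uniformly_elliptic \<nu> a"
    and super: "AE x in lebesgue. x \<in> \<Omega> \<longrightarrow> L_op a u x \<le> 0"
    and pos: "\<And>x. x \<in> \<Omega> \<Longrightarrow> 0 < u x"
    and Q: "Q_set k r0 \<psi> \<subseteq> \<Omega>" and R: "0 < R" "R < r0"
    and nonneg: "\<And>r. r \<in> {0..r0} \<Longrightarrow> 0 \<le> \<psi> r" and mono: "mono_on {0..r0} \<psi>"
    and K: "real CARD('n) * inverse \<nu> < K * \<nu>" "1 \<le> K"
    and e: "40 * K * e \<le> 1" and sums: "\<And>N. (\<Sum>j<N. \<psi> (R / 2 ^ j) / (R / 2 ^ j)) \<le> e"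
    and A: "A = 1 / (2 * K * R)"
    and v: "\<And>N y. v N y = vertical_part K A (\<lambda>j. \<psi> (R / 2 ^ j)) (\<lambda>j. R / 2 ^ j) N (y $ k)
                  - radial_part A (\<lambda>j. \<psi> (R / 2 ^ j)) (\<lambda>j. R / 2 ^ j) N (y \<bullet> y)"
  shows "\<exists>c>0. \<forall>N \<kappa> x. 0 < N \<longrightarrow> 2 * \<psi> (R / 2 ^ N) < \<kappa> \<longrightarrow> norm_prime k x \<le> R \<longrightarrow>
    0 \<le> x $ k \<longrightarrow> x $ k \<le> R \<longrightarrow> \<kappa> \<le> v N x \<longrightarrow> c * (v N x - \<kappa>) \<le> u x"
proof -
  define w where "w j = \<psi> (R / 2 ^ j)" for j :: nat
  define \<rho> where "\<rho> j = R / 2 ^ j" for j :: nat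
  let ?P = "\<lambda>N. vertical_part K A w \<rho> N" and ?G = "\<lambda>N. radial_part A w \<rho> N"
  have v: "v N y = ?P N (y $ k) - ?G N (y \<bullet> y)" for N y
    by (simp add: v w_def[abs_def] \<rho>_def[abs_def])
  have \<rho>: "0 < \<rho> j" "\<rho> j \<le> R" for j
  proof -
    show "0 < \<rho> j" using R by (simp add: \<rho>_def)
    have "R / 2 ^ j \<le> R / 1" using R by (intro frac_le) auto
    then show "\<rho> j \<le> R" by (simp add: \<rho>_def)
  qed
  have w: "0 \<le> w j" for j
    using nonneg[of "\<rho> j"] \<rho>[of j] R by (simp add: w_def \<rho>_def)
  have sums: "(\<Sum>j<N. w j / \<rho> j) \<le> e" for N using sums[of N] by (simp add: w_def \<rho>_def)
  have A0: "0 < A" and KAR: "K * A * R \<le> 1 / 2" using K R by (auto simp: A)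
  have "e < 1"
  proof (rule ccontr)
    assume "\<not> e < 1"
    then have "40 * 1 * 1 \<le> 40 * K * e" using K by (intro mult_mono) auto
    then show False using e by simp
  qed
  then have \<psi>R: "\<psi> R < R"
    using sums[of 1] R by (simp add: w_def \<rho>_def pos_divide_le_eq) (smt (verit) mult_less_cancel_right2)
  have \<psi>le: "\<psi> r \<le> \<psi> r'" if "0 \<le> r" "r \<le> r'" "r' \<le> R" for r r'
    using that R by (intro mono_onD[OF mono]) auto
  have P: "t \<le> ?P N t" "?P N t \<le> 2 * t" if "0 \<le> t" "t \<le> R" for N t
    using vertical_part_bounds[of \<rho> w K A t R N e] \<rho> w K A0 that KAR sums e by auto
  have prime_le: "(norm_prime k y)\<^sup>2 \<le> y \<bullet> y" for y :: "real ^ 'n"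
    using norm_prime_sq[of y k] by (simp add: power2_norm_eq_inner)
  have G0: "A * s \<le> ?G N s" if "0 \<le> s" for N s
    using that w by (auto simp: radial_part_def intro!: sum_nonneg mult_nonneg_nonneg divide_nonneg_nonneg)
  have G_nonneg: "0 \<le> ?G N (y \<bullet> y)" for N and y :: "real ^ 'n"
  proof -
    have "0 \<le> A * (y \<bullet> y)" using A0 by simp
    also have "\<dots> \<le> ?G N (y \<bullet> y)" by (intro G0) simp
    finally show ?thesis .
  qed
  define cyl where "cyl = {y :: real ^ 'n. norm_prime k y \<le> R \<and> 0 \<le> y $ k \<and> y $ k \<le> R}"
  have cont_k: "continuous_on S (\<lambda>y :: real ^ 'n. y $ k)" for S by (intro continuous_intros)
  have cyl: "compact cyl"
  proof -
    have "norm y \<le> 2 * R" if "y \<in> cyl" for y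
      using norm_le_norm_prime[of y k] that by (auto simp: cyl_def)
    then have "bounded cyl" by (auto simp: bounded_iff)
    moreover have "closed cyl"
      unfolding cyl_def
      by (intro closed_Collect_conj closed_Collect_le continuous_on_norm_prime cont_k continuous_on_const)
    ultimately show ?thesis by (simp add: compact_eq_bounded_closed)
  qed
  have cont_v: "continuous_on UNIV (v N)" for N
  proof -
    have "continuous_on UNIV (?P N)"
      using vertical_part_DERIV[where \<rho> = \<rho>, OF \<rho>(1)]
      by (intro continuous_at_imp_continuous_on ballI DERIV_isCont) blast
    then have "continuous_on UNIV (\<lambda>y :: real ^ 'n. ?P N (y $ k))"
      by (rule continuous_on_compose2[OF _ cont_k]) auto
    moreover have "continuous_on {0..} (?G N)"
      using radial_part_DERIV[where \<rho> = \<rho>, OF \<rho>(1)]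
      by (intro continuous_at_imp_continuous_on ballI DERIV_isCont) auto
    then have "continuous_on UNIV (\<lambda>y :: real ^ 'n. ?G N (y \<bullet> y))"
      by (rule continuous_on_compose2) (auto intro!: continuous_intros)
    ultimately show ?thesis unfolding v[abs_def] by (intro continuous_on_diff)
  qed
  define \<Gamma> where "\<Gamma> = {y \<in> cyl. y $ k = R} \<union>
      {y \<in> cyl. norm_prime k y = R \<and> \<psi> R + A * R\<^sup>2 / 4 \<le> y $ k}"
  have "compact \<Gamma>"
  proof -
    have "\<Gamma> = cyl \<inter> ({y. y $ k = R} \<union> {y. norm_prime k y = R \<and> \<psi> R + A * R\<^sup>2 / 4 \<le> y $ k})"
      by (auto simp: \<Gamma>_def)
    moreover have "closed ({y :: real ^ 'n. y $ k = R} \<union> {y. norm_prime k y = R \<and> \<psi> R + A * R\<^sup>2 / 4 \<le> y $ k})"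
      by (intro closed_Un closed_Collect_conj closed_Collect_le closed_Collect_eq
          continuous_on_norm_prime cont_k continuous_on_const)
    ultimately show ?thesis using cyl by (simp add: compact_Int_closed)
  qed
  have in_Q: "y \<in> \<Omega>" if "y \<in> cyl" "\<psi> (norm_prime k y) < y $ k" for y
  proof -
    have "0 \<le> \<psi> (norm_prime k y)"
      using that(1) R norm_prime_nonneg[of k y] by (intro nonneg) (auto simp: cyl_def)
    then show ?thesis using Q that R by (auto simp: Q_set_def cyl_def)
  qed
  have "\<Gamma> \<subseteq> \<Omega>"
  proof
    fix y assume y: "y \<in> \<Gamma>"
    have "0 < A * R\<^sup>2" using A0 R by simp
    moreover have "\<psi> (norm_prime k y) \<le> \<psi> R"
      using y norm_prime_nonneg[of k y] by (intro \<psi>le) (auto simp: \<Gamma>_def cyl_def)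
    ultimately show "y \<in> \<Omega>" using y \<psi>R by (intro in_Q) (auto simp: \<Gamma>_def)
  qed
  have cont_u: "continuous_on \<Omega> u" using C2 by (simp add: numeral_2_eq_2)
  obtain m where m: "0 < m" "\<And>y. y \<in> \<Gamma> \<Longrightarrow> m \<le> u y"
  proof (cases "\<Gamma> = {}")
    case False
    from continuous_attains_inf[OF \<open>compact \<Gamma>\<close> this continuous_on_subset[OF cont_u \<open>\<Gamma> \<subseteq> \<Omega>\<close>]]
    obtain y where "y \<in> \<Gamma>" "\<forall>z\<in>\<Gamma>. u y \<le> u z" by blast
    then show ?thesis using that[of "u y"] pos \<open>\<Gamma> \<subseteq> \<Omega>\<close> by blast
  qed (use that[of 1] in auto)
  \<comment> \<open>On the cylinder \<open>v \<le> 2 R\<close>, so \<open>c v \<le> m\<close>.\<close>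
  define c where "c = m / (2 * R)"
  have c: "0 < c" using m R by (simp add: c_def)
  show ?thesis
  proof (intro exI[of _ c] conjI allI impI c)
    fix N :: nat and \<kappa> :: real and x :: "real ^ 'n"
    assume N: "0 < N" and \<kappa>: "2 * \<psi> (R / 2 ^ N) < \<kappa>"
      and x: "norm_prime k x \<le> R" "0 \<le> x $ k" "x $ k \<le> R" "\<kappa> \<le> v N x"
    have \<kappa>0: "0 < \<kappa>" using w[of N] \<kappa> by (simp add: w_def)
    define S where "S = {y \<in> cyl. \<kappa> \<le> v N y}"
    have "x \<in> S" using x by (simp add: S_def cyl_def)
    \<comment> \<open>Below the graph, radii above \<open>R / 2 ^ N\<close> are covered by the sum in the radial part; for smaller
        radii \<open>\<kappa>\<close> makes up for the missing terms.\<close>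
    have above: "\<psi> (norm_prime k y) < y $ k" if y: "y \<in> S" for y
    proof (rule ccontr)
      assume low: "\<not> \<psi> (norm_prime k y) < y $ k"
      let ?r = "norm_prime k y"
      have r: "0 \<le> ?r" "?r \<le> R" using y norm_prime_nonneg[of k y] by (auto simp: S_def cyl_def)
      have vy: "v N y \<le> 2 * \<psi> ?r - ?G N (y \<bullet> y)"
        using P(2)[of "y $ k" N] y low by (auto simp: v S_def cyl_def)
      show False
      proof (cases "R / 2 ^ N < ?r")
        case True
        then obtain j where j: "j < N" "\<rho> (Suc j) < ?r" "?r \<le> \<rho> j"
          using dyadic_bracket[OF r(2) True] by (auto simp: \<rho>_def)
        have "A * (y \<bullet> y) + 2 * w j \<le> ?G N (y \<bullet> y)"
          using j(2) by (intro radial_part_ge[OF \<rho>(1) w j(1) _ prime_le]) (simp add: \<rho>_def)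
        moreover have "\<psi> ?r \<le> w j"
          using \<psi>le[OF r(1) j(3) \<rho>(2)] by (simp add: w_def \<rho>_def)
        moreover have "0 \<le> A * (y \<bullet> y)" using A0 by simp
        ultimately have "v N y \<le> 0" using vy by linarith
        then show False using y \<kappa>0 by (auto simp: S_def)
      next
        case False
        have "\<psi> ?r \<le> \<psi> (R / 2 ^ N)"
          using False \<rho>(2)[of N] by (intro \<psi>le r(1)) (auto simp: \<rho>_def)
        moreover note G_nonneg[of N y]
        ultimately show False using vy \<kappa> y by (simp add: S_def)
      qed
    qed
    have "S \<subseteq> \<Omega>" using above in_Q by (auto simp: S_def)
    have "compact S"
    proof -
      have "S = cyl \<inter> {y. \<kappa> \<le> v N y}" by (auto simp: S_def)
      moreover have "closed {y. \<kappa> \<le> v N y}"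
        by (intro closed_Collect_le cont_v continuous_on_const)
      ultimately show ?thesis using cyl by (simp add: compact_Int_closed)
    qed
    have "continuous_on S (\<lambda>y. u y - c * v N y)"
      by (intro continuous_intros continuous_on_subset[OF cont_u \<open>S \<subseteq> \<Omega>\<close>]
          continuous_on_subset[OF cont_v]) auto
    then obtain z where z: "z \<in> S" "\<And>y. y \<in> S \<Longrightarrow> u z - c * v N z \<le> u y - c * v N y"
      using continuous_attains_inf[OF \<open>compact S\<close>] \<open>x \<in> S\<close> by blast
    show "c * (v N x - \<kappa>) \<le> u x"
    proof (rule ccontr)
      assume "\<not> c * (v N x - \<kappa>) \<le> u x"
      then have uz: "u z < c * (v N z - \<kappa>)"
        using z(2)[OF \<open>x \<in> S\<close>] by (simp add: right_diff_distrib)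
      have "0 < u z" using pos z(1) \<open>S \<subseteq> \<Omega>\<close> by blast
      with uz have "0 < c * (v N z - \<kappa>)" by linarith
      then have vz: "\<kappa> < v N z" using c by (simp add: zero_less_mult_iff)
      have zc: "norm_prime k z \<le> R" "0 \<le> z $ k" "z $ k \<le> R" using z(1) by (auto simp: S_def cyl_def)
      have zk: "0 < z $ k"
        using above[OF z(1)] nonneg[of "norm_prime k z"] zc R norm_prime_nonneg[of k z] by simp
      have "z \<notin> \<Gamma>"
      proof
        assume "z \<in> \<Gamma>"
        have "v N z - \<kappa> \<le> 2 * R"
          using G_nonneg[of N z] P(2)[OF zc(2,3), of N] zc(3) \<kappa>0 unfolding v by linarith
        then have "c * (v N z - \<kappa>) \<le> c * (2 * R)" using c by (intro mult_left_mono) auto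
        then show False using uz m(2)[OF \<open>z \<in> \<Gamma>\<close>] R by (simp add: c_def)
      qed
      have "norm_prime k z \<noteq> R"
      proof
        assume zR: "norm_prime k z = R"
        have low: "z $ k < \<psi> R + A * R\<^sup>2 / 4"
          using \<open>z \<notin> \<Gamma>\<close> zR z(1) by (auto simp: \<Gamma>_def S_def)
        have "A * (z \<bullet> z) + 2 * w 0 \<le> ?G N (z \<bullet> z)"
          using zR R by (intro radial_part_ge[OF \<rho>(1) w N _ prime_le]) (simp add: \<rho>_def)
        moreover have "A * R\<^sup>2 \<le> A * (z \<bullet> z)"
          using prime_le[of z] zR A0 by (intro mult_left_mono) auto
        moreover have "w 0 = \<psi> R" by (simp add: w_def)
        moreover have "0 < A * R\<^sup>2" using A0 R by simp
        ultimately have "v N z < 0" using P(2)[OF zc(2,3), of N] low unfolding v by linarith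
        then show False using vz \<kappa>0 by simp
      qed
      with zc have z1: "norm_prime k z < R" by simp
      have z2: "z $ k < R" using \<open>z \<notin> \<Gamma>\<close> z(1) zc(3) by (force simp: \<Gamma>_def S_def)
      have "open {y. norm_prime k y < R \<and> 0 < y $ k \<and> y $ k < R \<and> \<kappa> < v N y}"
        by (intro open_Collect_conj open_Collect_less continuous_on_norm_prime cont_k cont_v continuous_on_const)
      then have "\<forall>\<^sub>F y in nhds z. y \<in> {y. norm_prime k y < R \<and> 0 < y $ k \<and> y $ k < R \<and> \<kappa> < v N y}"
        using z1 z2 zk vz by (intro eventually_nhds_in_open) auto
      then have touch: "\<forall>\<^sub>F y in nhds z. u z - c * v N z \<le> u y - c * v N y"
        by (rule eventually_mono) (auto simp: S_def cyl_def intro!: z(2))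
      have "z \<in> \<Omega>" using z(1) \<open>S \<subseteq> \<Omega>\<close> by blast
      let ?\<beta> = "2 * c * radial_slope A w \<rho> N (z \<bullet> z)"
      have \<beta>: "0 < ?\<beta>" using c A0 radial_slope_ge[of w A \<rho> N "z \<bullet> z", OF w] by simp
      have hess: "?\<beta> * (K * (\<xi> $ k)\<^sup>2 - (norm \<xi>)\<^sup>2) \<le>
          (\<Sum>i\<in>UNIV. \<Sum>j\<in>UNIV. D i (D j u) z * \<xi> $ i * \<xi> $ j)" for \<xi>
        by (rule hessian_above_touching_barrier[where v = "v N", OF assms(1) \<open>z \<in> \<Omega>\<close> C2 \<rho>(1) w _ _ v touch])
           (use c K in auto)
      show False
        by (rule no_strictly_elliptic_hessian[OF ell assms(1) C2 super \<open>z \<in> \<Omega>\<close> K(1) _ \<beta> hess])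
           (use K(2) in simp)
    qed
  qed
qed

theorem theorem1p8:
  fixes k :: "'n::finite"
    and \<Omega> :: "(real ^ 'n) set"
    and r0 \<nu> :: real
    and \<psi> :: "real \<Rightarrow> real"
    and a :: "'n \<Rightarrow> 'n \<Rightarrow> real ^ 'n \<Rightarrow> real"
    and u :: "real ^ 'n \<Rightarrow> real"
  assumes "bounded \<Omega>" and "open \<Omega>" and "0 \<in> frontier \<Omega>"
    and "0 < r0"
    and "\<And>r. r \<in> {0..r0} \<Longrightarrow> 0 \<le> \<psi> r"
    and "mono_on {0..r0} \<psi>"
    and "\<psi> r0 < r0"
    and "I_int r0 \<psi> < \<infinity>"
    and "Q_set k r0 \<psi> \<subseteq> \<Omega>"
    and "uniformly_elliptic \<nu> a"
    and "Ck_on 2 \<Omega> u" and "continuous_on (closure \<Omega>) u"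
    and "\<And>x. x \<in> \<Omega> \<Longrightarrow> 0 < u x"
    and "AE x in lebesgue. x \<in> \<Omega> \<longrightarrow> L_op a u x \<le> 0"
    and "u 0 = 0"
  shows "\<forall>l::real ^ 'n. 0 < l $ k \<longrightarrow>
    (\<forall>\<^sub>F t in at_right 0. t *\<^sub>R l \<in> Q_set k r0 \<psi>) \<and>
    0 < Liminf (at_right 0) (\<lambda>t. ereal (inverse t * u (t *\<^sub>R l)))"
proof (intro allI impI)
  fix l :: "real ^ 'n"
  assume lk: "0 < l $ k"
  have nl: "l $ k \<le> norm l" using component_le_norm_cart[of l k] by simp
  with lk have l0: "0 < norm l" by linarith
  have \<nu>: "0 < \<nu>" "\<nu> \<le> 1" using assms(10) by (auto simp: uniformly_elliptic_def)
  \<comment> \<open>With this value \<open>K \<nu> = n / \<nu> + 1\<close>.\<close>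
  define K where "K = (real CARD('n) * inverse \<nu> + 1) / \<nu>"
  have K: "real CARD('n) * inverse \<nu> < K * \<nu>" "1 \<le> K"
  proof -
    show "real CARD('n) * inverse \<nu> < K * \<nu>" using \<nu> by (simp add: K_def)
    have "0 \<le> real CARD('n) * inverse \<nu>" using \<nu> by simp
    then show "1 \<le> K" using \<nu> unfolding K_def by (subst le_divide_eq_1_pos) linarith+
  qed
  \<comment> \<open>The first bound makes \<open>P t \<le> 2 t\<close> possible; the second keeps the Dini terms of the radial part
      below a quarter of the slope \<open>l\<^sub>k\<close> along the ray.\<close>
  define e where "e = min (1 / (40 * K)) (l $ k / (20 * norm l))"
  have e: "0 < e" "40 * K * e \<le> 1" "20 * norm l * e \<le> l $ k"
  proof -
    show "0 < e" using K lk l0 by (simp add: e_def)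
    have "40 * K * e \<le> 40 * K * (1 / (40 * K))" using K by (intro mult_left_mono) (auto simp: e_def)
    then show "40 * K * e \<le> 1" using K by simp
    have "20 * norm l * e \<le> 20 * norm l * (l $ k / (20 * norm l))"
      by (intro mult_left_mono) (auto simp: e_def)
    then show "20 * norm l * e \<le> l $ k" using l0 by simp
  qed
  obtain R where R: "0 < R" "R < r0" and sums: "\<And>N. (\<Sum>j<N. \<psi> (R / 2 ^ j) / (R / 2 ^ j)) \<le> e"
    using dyadic_sums_small[OF assms(4-6,8) e(1)] by blast
  have \<rho>: "0 < R / 2 ^ j" "R / 2 ^ j \<le> R" for j :: nat
  proof -
    have "R / 2 ^ j \<le> R / 1" using R by (intro frac_le) auto
    then show "R / 2 ^ j \<le> R" by simp
  qed (use R in simp)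
  have \<psi>\<rho>: "\<psi> (R / 2 ^ j) \<le> e * (R / 2 ^ j)" for j
  proof -
    have "0 \<le> \<psi> (R / 2 ^ i) / (R / 2 ^ i)" for i
      using assms(5)[of "R / 2 ^ i"] \<rho>[of i] R by simp
    then have "\<psi> (R / 2 ^ j) / (R / 2 ^ j) \<le> (\<Sum>i<Suc j. \<psi> (R / 2 ^ i) / (R / 2 ^ i))"
      by (intro member_le_sum) auto
    then have "\<psi> (R / 2 ^ j) / (R / 2 ^ j) \<le> e" using sums[of "Suc j"] by linarith
    then show ?thesis using \<rho>(1)[of j] by (simp only: pos_divide_le_eq)
  qed
  have small: "\<exists>N>0. e * (R / 2 ^ N) < d" if d: "0 < d" for d
  proof -
    obtain n where n: "(1 / 2) ^ n < d / (e * R)"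
      using real_arch_pow_inv[of "d / (e * R)" "1 / 2"] d e(1) R(1) by auto
    then have "e * (R / 2 ^ n) < d" using e R by (simp add: field_simps)
    moreover have "e * (R / 2 ^ Suc n) \<le> e * (R / 2 ^ n)"
      using e R by (intro mult_left_mono frac_le) auto
    ultimately show ?thesis by (intro exI[of _ "Suc n"]) linarith
  qed
  have \<psi>lin: "\<psi> r \<le> 2 * e * r" if r: "0 < r" "r \<le> R" for r
  proof -
    obtain N where "e * (R / 2 ^ N) < e * r" using small[of "e * r"] e r by auto
    then have "R / 2 ^ N < r" using e by (simp only: mult_less_cancel_left_pos)
    then obtain j where j: "R / 2 ^ Suc j < r" "r \<le> R / 2 ^ j"
      using dyadic_bracket[OF r(2)] by blast
    have "\<psi> r \<le> \<psi> (R / 2 ^ j)"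
      using r j(2) \<rho>[of j] R by (intro mono_onD[OF assms(6)]) auto
    also have "\<dots> \<le> e * (R / 2 ^ j)" by (rule \<psi>\<rho>)
    also have "\<dots> \<le> e * (2 * r)" using j(1) e by (intro mult_left_mono) auto
    finally show ?thesis by simp
  qed
  \<comment> \<open>The largest value with \<open>K A t\<^sup>2 \<le> t / 2\<close> on \<open>[0, R]\<close>.\<close>
  define A where "A = 1 / (2 * K * R)"
  have A0: "0 < A" using K R by (simp add: A_def)
  define v where "v N y = vertical_part K A (\<lambda>j. \<psi> (R / 2 ^ j)) (\<lambda>j. R / 2 ^ j) N (y $ k)
      - radial_part A (\<lambda>j. \<psi> (R / 2 ^ j)) (\<lambda>j. R / 2 ^ j) N (y \<bullet> y)" for N and y :: "real ^ 'n"
  obtain c where c: "0 < c" and comp: "\<And>N \<kappa> x. 0 < N \<Longrightarrow> 2 * \<psi> (R / 2 ^ N) < \<kappa> \<Longrightarrow>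
      norm_prime k x \<le> R \<Longrightarrow> 0 \<le> x $ k \<Longrightarrow> x $ k \<le> R \<Longrightarrow> \<kappa> \<le> v N x \<Longrightarrow> c * (v N x - \<kappa>) \<le> u x"
    using comparison_with_barrier[OF assms(2,11,10,14,13,9) R assms(5,6) K e(2) sums A_def v_def]
    by blast
  \<comment> \<open>Up to this time the ray stays in the cylinder and the quadratic term of the barrier costs at
      most a quarter of the slope.\<close>
  define T where "T = min (R / norm l) (l $ k / (4 * A * (norm l)\<^sup>2))"
  have T0: "0 < T" using R l0 lk A0 by (simp add: T_def)
  have ev: "\<forall>\<^sub>F t in at_right 0. 0 < t \<and> t < T"
    using T0 by (auto simp: eventually_at_right)
  have key: "t *\<^sub>R l \<in> Q_set k r0 \<psi> \<and> c * (l $ k / 4) \<le> inverse t * u (t *\<^sub>R l)"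
    if t: "0 < t" "t < T" for t
  proof -
    have tl: "t * norm l \<le> R"
      using t l0 by (simp add: T_def less_imp_le pos_less_divide_eq)
    have tA: "A * (t * norm l)\<^sup>2 \<le> t * (l $ k / 4)"
    proof -
      have "t * (4 * A * (norm l)\<^sup>2) \<le> l $ k"
        using t l0 A0 by (simp add: T_def less_imp_le pos_less_divide_eq)
      then have "t * (t * (4 * A * (norm l)\<^sup>2)) \<le> t * (l $ k)"
        using t by (intro mult_left_mono) auto
      then show ?thesis by (simp add: power2_eq_square algebra_simps)
    qed
    have prime: "0 \<le> norm_prime k (t *\<^sub>R l)" "norm_prime k (t *\<^sub>R l) \<le> t * norm l"
      using norm_prime_nonneg norm_prime_le_norm[of k "t *\<^sub>R l"] t by auto
    have hk: "0 < t * l $ k" "t * l $ k \<le> R"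
    proof -
      show "0 < t * l $ k" using t lk by simp
      have "t * l $ k \<le> t * norm l" using nl t by (intro mult_left_mono) auto
      then show "t * l $ k \<le> R" using tl by linarith
    qed
    have te: "20 * (t * norm l) * e \<le> t * l $ k"
      using mult_left_mono[OF e(3), of t] t by (simp add: mult_ac)
    have "\<psi> (norm_prime k (t *\<^sub>R l)) \<le> \<psi> (t * norm l)"
      using prime tl R by (intro mono_onD[OF assms(6)]) auto
    also have "\<dots> \<le> 2 * e * (t * norm l)" using t l0 tl by (intro \<psi>lin) auto
    also have "\<dots> < t * l $ k" using te hk(1) by (simp add: mult_ac)
    finally have "\<psi> (norm_prime k (t *\<^sub>R l)) < t * l $ k" .
    moreover have "0 \<le> \<psi> (norm_prime k (t *\<^sub>R l))"
      using prime tl R by (intro assms(5)) auto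
    ultimately have "t *\<^sub>R l \<in> Q_set k r0 \<psi>"
      using prime tl hk R by (simp add: Q_set_def)
    moreover have "c * (l $ k / 4) \<le> inverse t * u (t *\<^sub>R l)"
    proof -
      \<comment> \<open>Of the height \<open>t l\<^sub>k\<close>, the two terms of the radial part and \<open>\<kappa>\<close> take a quarter each.\<close>
      define \<kappa> where "\<kappa> = t * l $ k / 4"
      obtain N where N: "0 < N" "e * (R / 2 ^ N) < \<kappa> / 2"
        using small[of "\<kappa> / 2"] hk by (auto simp: \<kappa>_def)
      have \<kappa>: "2 * \<psi> (R / 2 ^ N) < \<kappa>" using N(2) \<psi>\<rho>[of N] by linarith
      have w: "0 \<le> \<psi> (R / 2 ^ j)" for j using \<rho>[of j] R by (intro assms(5)) auto
      have "t * l $ k \<le> vertical_part K A (\<lambda>j. \<psi> (R / 2 ^ j)) (\<lambda>j. R / 2 ^ j) N (t * l $ k)"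
        using \<rho>(1) w K A0 hk sums e(2) R
        by (intro vertical_part_bounds(1)[where R = R and e = e]) (auto simp: A_def)
      moreover have "radial_part A (\<lambda>j. \<psi> (R / 2 ^ j)) (\<lambda>j. R / 2 ^ j) N ((t * norm l)\<^sup>2) \<le>
          A * (t * norm l)\<^sup>2 + 5 * (t * norm l) * e"
        using \<rho>(1) w t sums by (intro radial_part_le) auto
      moreover have "(t *\<^sub>R l) \<bullet> (t *\<^sub>R l) = (t * norm l)\<^sup>2"
        using t by (simp flip: power2_norm_eq_inner)
      ultimately have "t * l $ k - (A * (t * norm l)\<^sup>2 + 5 * (t * norm l) * e) \<le> v N (t *\<^sub>R l)"
        by (simp add: v_def)
      then have vN: "2 * \<kappa> \<le> v N (t *\<^sub>R l)" using tA te unfolding \<kappa>_def by linarith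
      have "c * \<kappa> \<le> c * (v N (t *\<^sub>R l) - \<kappa>)" using vN c by (intro mult_left_mono) auto
      also have "\<dots> \<le> u (t *\<^sub>R l)"
        using N(1) \<kappa> prime tl hk vN w[of N] by (intro comp) auto
      finally have "inverse t * (c * \<kappa>) \<le> inverse t * u (t *\<^sub>R l)"
        using t by (intro mult_left_mono) auto
      moreover have "inverse t * (c * \<kappa>) = c * (l $ k / 4)" using t by (simp add: \<kappa>_def)
      ultimately show ?thesis by simp
    qed
    ultimately show ?thesis by blast
  qed
  show "(\<forall>\<^sub>F t in at_right 0. t *\<^sub>R l \<in> Q_set k r0 \<psi>) \<and>
    0 < Liminf (at_right 0) (\<lambda>t. ereal (inverse t * u (t *\<^sub>R l)))"
  proof
    show "\<forall>\<^sub>F t in at_right 0. t *\<^sub>R l \<in> Q_set k r0 \<psi>"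
      using ev key by (auto elim!: eventually_mono)
    have "ereal (c * (l $ k / 4)) \<le> Liminf (at_right 0) (\<lambda>t. ereal (inverse t * u (t *\<^sub>R l)))"
      using ev key by (intro Liminf_bounded) (auto elim!: eventually_mono)
    moreover have "0 < ereal (c * (l $ k / 4))" using c lk by simp
    ultimately show "0 < Liminf (at_right 0) (\<lambda>t. ereal (inverse t * u (t *\<^sub>R l)))"
      by (rule less_le_trans[rotated])
  qed
qed

end
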